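(* Let $\Omega\subset\mathbb{R}^d$ be a bounded Lipschitz domain and let $R>0$ be such that $\delta_\Omega(x)<R$ for all $x\in\Omega$. (i) There exists a constant $C=C(d,\Omega)>0$ (depending only on $d$ and $\Omega$) such that for every integer $m\ge2$, every $\frac12\le s<1$ and all $u\in W^{s,1}(\Omega)$, $$\int_\Omega\frac{|u(x)|}{\delta_\Omega^s(x)}\,\mathcal{L}_1\!\left(\frac{\delta_\Omega(x)}{R}\right)\cdots\mathcal{L}_{m-1}\!\left(\frac{\delta_\Omega(x)}{R}\right)\mathcal{L}_m^2\!\left(\frac{\delta_\Omega(x)}{R}\right)dx\le C2^m(1-s)[u]_{W^{s,1}(\Omega)}+C2^m\|u\|_{L^1(\Omega)}.$$ (ii) For any $0<\alpha<\frac12$, there exists a constant $C=C(d,\Omega)>0$ (depending only on $d$ and $\Omega$) such that for every $\frac12\le s<1$ and all $u\in W^{s,1}(\Omega)$, $$\sum_{m=2}^\infty\alpha^m\int_\Omega\frac{|u(x)|}{\delta_\Omega^s(x)}\,\mathcal{L}_1\!\left(\frac{\delta_\Omega(x)}{R}\right)\cdots\mathcal{L}_{m-1}\!\left(\frac{\delta_\Omega(x)}{R}\right)\mathcal{L}_m^2\!\left(\frac{\delta_\Omega(x)}{R}\right)dx\le C\left(\frac{4\alpha^2}{1-2\alpha}\right)\left\{(1-s)[u]_{W^{s,1}(\Omega)}+\|u\|_{L^1(\Omega)}\right\}.$$ (iii) The series inequality in (ii) fails when $\alpha\ge1$: for $\alpha\ge1$ there is no finite constant $C'$ (independent of $s$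 and $u$) such that, for all $\frac12\le s<1$ and all $u\in W^{s,1}(\Omega)$, the left-hand side of the inequality in (ii) is at most $C'\{(1-s)[u]_{W^{s,1}(\Omega)}+\|u\|_{L^1(\Omega)}\}$.
   Context: For a bounded domain $\Omega\subset\mathbb{R}^d$, $d\ge1$, $\delta_\Omega(x)=\min_{y\in\partial\Omega}|x-y|$ is the distance to the boundary. The functions $\mathcal{L}_m$ are defined on $(0,1)$ by $\mathcal{L}_1(t)=\frac{1}{1-\ln t}$ and recursively $\mathcal{L}_m(t)=\mathcal{L}_1(\mathcal{L}_{m-1}(t))$ for $m\ge2$; $\mathcal{L}_m^2(t)$ means $(\mathcal{L}_m(t))^2$. For $s\in(0,1)$, $[u]_{W^{s,1}(\Omega)}:=\int_\Omega\int_\Omega\frac{|u(x)-u(y)|}{|x-y|^{d+s}}\,dx\,dy$ and $W^{s,1}(\Omega):=\{u\in L^1(\Omega):[u]_{W^{s,1}(\Omega)}<\infty\}$. *)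

theory Defs
  imports "HOL-Analysis.Analysis"
begin

text \<open>Near each boundary point the domain is the strict epigraph of a Lipschitz function, in
  suitable orthonormal coordinates.  The last coordinate axis is spanned by the unit
  vector \<open>\<nu>\<close>; the hyperplane orthogonal to \<open>\<nu>\<close> carries the remaining \<open>d - 1\<close> coordinates,
  and reduces to \<open>{0}\<close> for \<open>d = 1\<close>.\<close>

definition bounded_Lipschitz_domain :: "(real^'n) set \<Rightarrow> bool" where
  "bounded_Lipschitz_domain \<Omega> \<longleftrightarrow>
     \<Omega> \<noteq> {} \<and> open \<Omega> \<and> connected \<Omega> \<and> bounded \<Omega> \<and>
     (\<forall>p\<in>frontier \<Omega>. \<exists>r>0. \<exists>\<nu> \<phi> K.
        norm \<nu> = 1 \<and> K-lipschitz_on {y. y \<bullet> \<nu> = 0} \<phi> \<and>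
        \<Omega> \<inter> ball p r = {x \<in> ball p r. \<phi> (x - (x \<bullet> \<nu>) *\<^sub>R \<nu>) < x \<bullet> \<nu>})"

definition bdist :: "(real^'n) set \<Rightarrow> real^'n \<Rightarrow> real" where
  "bdist \<Omega> x = infdist x (frontier \<Omega>)"

definition log_L1 :: "real \<Rightarrow> real" where
  "log_L1 t = 1 / (1 - ln t)"

text \<open>Only \<open>m \<ge> 1\<close> and \<open>0 < t < 1\<close> are meaningful.\<close>

definition log_L :: "nat \<Rightarrow> real \<Rightarrow> real" where
  "log_L m t = (log_L1 ^^ m) t"

definition log_weight :: "nat \<Rightarrow> real \<Rightarrow> real" where
  "log_weight m t = (\<Prod>k=1..m-1. log_L k t) * (log_L m t)\<^sup>2"

text \<open>The integrals below are taken in \<open>[0, \<infinity>]\<close>.  On the diagonal \<open>x = y\<close> the integrand of the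
  seminorm is \<open>0 / 0 = 0\<close>, which does not matter as the diagonal is a null set.\<close>

definition W_seminorm :: "real \<Rightarrow> (real^'n) set \<Rightarrow> (real^'n \<Rightarrow> real) \<Rightarrow> ennreal" where
  "W_seminorm s \<Omega> u =
     (\<integral>\<^sup>+x. (\<integral>\<^sup>+y. ennreal (\<bar>u x - u y\<bar> / norm (x - y) powr (real CARD('n) + s))
        \<partial>lebesgue_on \<Omega>) \<partial>lebesgue_on \<Omega>)"

definition L1_norm :: "(real^'n) set \<Rightarrow> (real^'n \<Rightarrow> real) \<Rightarrow> ennreal" where
  "L1_norm \<Omega> u = (\<integral>\<^sup>+x. ennreal \<bar>u x\<bar> \<partial>lebesgue_on \<Omega>)"

text \<open>Elements are functions on the whole space rather than classes of functions on \<open>\<Omega>\<close>; their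
  values outside \<open>\<Omega>\<close> are unconstrained and never used.\<close>

definition W_space :: "real \<Rightarrow> (real^'n) set \<Rightarrow> (real^'n \<Rightarrow> real) set" where
  "W_space s \<Omega> = {u. integrable (lebesgue_on \<Omega>) u \<and> W_seminorm s \<Omega> u < \<infinity>}"

definition hardy_integral ::
    "real \<Rightarrow> nat \<Rightarrow> real \<Rightarrow> (real^'n) set \<Rightarrow> (real^'n \<Rightarrow> real) \<Rightarrow> ennreal" where
  "hardy_integral R m s \<Omega> u =
     (\<integral>\<^sup>+x. ennreal (\<bar>u x\<bar> / bdist \<Omega> x powr s * log_weight m (bdist \<Omega> x / R))
        \<partial>lebesgue_on \<Omega>)"

definition hardy_series ::
    "real \<Rightarrow> real \<Rightarrow> real \<Rightarrow> (real^'n) set \<Rightarrow> (real^'n \<Rightarrow> real) \<Rightarrow> ennreal" where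
  "hardy_series \<alpha> R s \<Omega> u =
     (\<Sum>j. ennreal (\<alpha> ^ (j + 2)) * hardy_integral R (j + 2) s \<Omega> u)"

end

theory Submission
  imports Defs
begin

text \<open>The constant obtained does not depend on \<open>m\<close>.  In a boundary chart let \<open>\<eta>\<close> be the height
  above the graph, \<open>\<delta> \<le> \<eta> \<le> K \<delta>\<close>, and let \<open>T\<close> stretch heights by a fixed factor
  \<open>\<mu> > 1\<close> close to \<open>1\<close>; \<open>T\<close> has constant Jacobian \<open>\<mu>\<close>.  Testing \<open>|u(Tx)| - |u(x)|\<close> against
  \<open>\<eta>\<^sup>-\<^sup>s L\<^sub>m(\<mu> \<eta> / R)\<close> and changing variables turns the difference into one of \<open>L\<^sub>m\<close> at \<open>\<mu> \<eta> / R\<close> and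
  \<open>\<eta> / R\<close>, which dominates the weight because \<open>t L\<^sub>m'(t) = L\<^sub>1(t) \<dots> L\<^sub>m\<^sub>-\<^sub>1(t) L\<^sub>m(t)\<^sup>2\<close>.  As \<open>L\<^sub>m \<le> 1\<close>, the
  error is at most \<open>\<integral> |u(Tx) - u(x)| \<eta>\<^sup>-\<^sup>s dx\<close>, which a Poincare inequality with the sharp factor
  \<open>1 - s\<close> on balls of radius comparable to \<open>\<delta>\<close> bounds by \<open>(1 - s) [u]\<close>.

  For \<open>\<alpha> \<ge> 1\<close> take \<open>u = 1\<close> and let \<open>s\<close> tend to \<open>1\<close>: by the same derivative formula each integral
  is bounded below by a constant multiple of \<open>L\<^sub>m(t)\<close> for a fixed \<open>t\<close>, and \<open>L\<^sub>m(t) \<ge> t\<close>.\<close>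

section \<open>Iterated logarithms\<close>

text \<open>The seminorm controls differences of u only, so the integration by parts behind a Hardy
  inequality is replaced by a comparison of the heights \<eta> and \<mu> \<eta>. The two integrals
  whose difference is wanted may both be infinite; hence heights below e are cut off, the common
  part is cancelled, and e is sent to 0. Pulling \<eta>^(-s) back along T costs \<mu>^s \<le> \<mu>,
  which the Jacobian \<mu> absorbs: the powers cancel uniformly up to s = 1 and only the increment
  of L_m survives. Stretching leads away from the boundary, so the one leak is the shell a \<le>
  \<eta> < \<mu> a at the top of the chart, where \<eta>^(-s) \<le> 1/a and the L1 norm pays. The
  weight decreases in R, so near the boundary R is replaced by the boundary distance of one fixed
  point of \<Omega>, which R exceeds; this makes the constant independent of R. In the failure for
  \<alpha> \<ge> 1 the order of choices matters: the number of terms, a height at which the iterated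
  logarithms in question are small, and only then s, since that height enters through its power 1 -
  s.\<close>

lemma log_L_Suc: "log_L (Suc m) t = log_L1 (log_L m t)"
  by (simp add: log_L_def)

lemma log_L_0 [simp]: "log_L 0 t = t"
  by (simp add: log_L_def)

lemma log_L1_denom_gt_1:
  fixes t :: real
  assumes "0 < t" "t < 1"
  shows "1 < 1 - ln t"
  using ln_less_zero[OF assms] by linarith

lemma log_L1_pos: "0 < t \<Longrightarrow> t < 1 \<Longrightarrow> 0 < log_L1 t"
  unfolding log_L1_def using log_L1_denom_gt_1[of t] by (intro divide_pos_pos) linarith+

lemma log_L1_less_1: "0 < t \<Longrightarrow> t < 1 \<Longrightarrow> log_L1 t < 1"
  unfolding log_L1_def using log_L1_denom_gt_1[of t] by (subst divide_less_eq_1_pos) linarith+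

text \<open>Amounts to ln (1/t) \<le> 1/t - 1. Consequently the iterates increase with m and
  \<open>log_L m t\<close> never drops below t, which bounds the terms of the divergent series from
  below.\<close>

lemma log_L1_ge:
  assumes "0 < t" "t < 1"
  shows "t \<le> log_L1 t"
proof -
  have "1 - ln t \<le> 1 / t"
    using ln_add_one_self_le_self2[of "1/t - 1"] assms by (simp add: ln_div)
  then have "t * (1 - ln t) \<le> 1" using assms by (simp add: field_simps)
  then show ?thesis
    unfolding log_L1_def using log_L1_denom_gt_1[OF assms] by (subst pos_le_divide_eq) linarith+
qed

lemma log_L1_mono:
  assumes "0 < t" "t \<le> t'" "t' < 1"
  shows "log_L1 t \<le> log_L1 t'"
proof -
  have "1 < 1 - ln t'" using assms by (intro log_L1_denom_gt_1) auto
  moreover have "ln t \<le> ln t'" using assms by simp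
  ultimately show ?thesis
    unfolding log_L1_def by (intro divide_left_mono mult_pos_pos) linarith+
qed

lemma log_L_pos_less_1:
  assumes "0 < t" "t < 1"
  shows "0 < log_L m t \<and> log_L m t < 1"
  by (induction m) (use assms log_L1_pos log_L1_less_1 in \<open>auto simp: log_L_Suc\<close>)

lemmas log_L_pos = log_L_pos_less_1[THEN conjunct1]
lemmas log_L_less_1 = log_L_pos_less_1[THEN conjunct2]

lemma log_L_mono:
  assumes "0 < t" "t \<le> t'" "t' < 1"
  shows "log_L m t \<le> log_L m t'"
proof (induction m)
  case (Suc m)
  then show ?case
    using assms log_L_pos[of t m] log_L_less_1[of t' m] by (simp add: log_L_Suc log_L1_mono)
qed (use assms in simp)

lemma log_L_incseq:
  assumes "0 < t" "t < 1" "m \<le> n"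
  shows "log_L m t \<le> log_L n t"
  using assms(3)
proof (induction n rule: dec_induct)
  case (step n)
  then show ?case
    using log_L1_ge[OF log_L_pos[OF assms(1,2)] log_L_less_1[OF assms(1,2)], of n]
    by (simp add: log_L_Suc)
qed simp

text \<open>Solving \<open>log_L1 y \<le> e\<close> for y gives y \<le> exp (1 - 1/e), so this
  tolerance is passed down to level m.\<close>

lemma log_L_small:
  assumes "0 < e"
  shows "\<exists>t. 0 < t \<and> t < 1 \<and> log_L m t \<le> e"
  using assms
proof (induction m arbitrary: e)
  case 0
  then show ?case by (intro exI[of _ "min e (1/2)"]) auto
next
  case (Suc m)
  obtain t where t: "0 < t" "t < 1" "log_L m t \<le> exp (1 - 1/e)"
    using Suc.IH[of "exp (1 - 1/e)"] by auto
  have *: "0 < log_L m t" "log_L m t < 1" using t log_L_pos log_L_less_1 by auto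
  have "ln (log_L m t) \<le> 1 - 1/e"
    using ln_mono[OF t(3) *(1)] by simp
  then have "1/e \<le> 1 - ln (log_L m t)" by linarith
  then have "1 / (1 - ln (log_L m t)) \<le> 1 / (1/e)"
    using Suc.prems log_L1_denom_gt_1[OF *] by (intro divide_left_mono mult_pos_pos) (auto simp del: ln_less_zero_iff)
  then have "log_L1 (log_L m t) \<le> e" by (simp add: log_L1_def)
  then show ?case using t by (auto simp: log_L_Suc)
qed

lemma log_weight_pos:
  assumes "0 < t" "t < 1"
  shows "0 < log_weight m t"
  unfolding log_weight_def using log_L_pos[OF assms]
  by (intro mult_pos_pos prod_pos zero_less_power) auto

lemma log_weight_le_1:
  assumes "0 < t" "t < 1"
  shows "log_weight m t \<le> 1"
proof -
  have "(\<Prod>k=1..m-1. log_L k t) \<le> 1"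
    using log_L_pos[OF assms] log_L_less_1[OF assms] by (intro prod_le_1) (auto intro: less_imp_le)
  moreover have "0 \<le> (\<Prod>k=1..m-1. log_L k t)"
    using log_L_pos[OF assms] by (intro prod_nonneg) (auto intro: less_imp_le)
  ultimately show ?thesis
    unfolding log_weight_def using log_L_pos[OF assms] log_L_less_1[OF assms]
    by (intro mult_le_one power_le_one) (auto intro: less_imp_le)
qed

lemma log_weight_mono:
  assumes "0 < t" "t \<le> t'" "t' < 1"
  shows "log_weight m t \<le> log_weight m t'"
proof -
  have pos: "0 \<le> log_L k t" for k using log_L_pos[of t k] assms by simp
  have pos': "0 \<le> log_L k t'" for k using log_L_pos[of t' k] assms by simp
  show ?thesis
    unfolding log_weight_def
    by (intro mult_mono prod_mono power_mono prod_nonneg)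
       (use pos pos' log_L_mono[OF assms] in auto)
qed

section \<open>Derivatives and increments of the iterated logarithms\<close>

lemma DERIV_log_L1:
  assumes "0 < t" "t < 1"
  shows "(log_L1 has_real_derivative (log_L1 t)\<^sup>2 / t) (at t)"
proof -
  have "1 - ln t \<noteq> 0" using log_L1_denom_gt_1[OF assms] by linarith
  then show ?thesis
    unfolding log_L1_def[abs_def] using assms(1)
    by (auto intro!: derivative_eq_intros simp: power2_eq_square divide_simps)
qed

text \<open>By the chain rule a further level multiplies the derivative by
  \<open>(log_L1 ?y)\<^sup>2 / ?y\<close>, where \<open>?y\<close> is the value reached so far: the
  division lowers the final square of the weight to a first power, which joins the product, and the
  numerator is the new square.\<close>

lemma DERIV_log_L:
  assumes "0 < t" "t < 1"
  shows "(log_L (Suc m) has_real_derivative log_weight (Suc m) t / t) (at t)"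
proof (induction m)
  case 0
  have "log_L (Suc 0) = log_L1"
    by (simp add: fun_eq_iff log_L_Suc)
  then show ?case using DERIV_log_L1[OF assms] by (simp add: log_weight_def)
next
  case (Suc m)
  let ?y = "log_L (Suc m) t"
  have y: "0 < ?y" "?y < 1" using log_L_pos[OF assms] log_L_less_1[OF assms] by auto
  have "((\<lambda>x. log_L1 (log_L (Suc m) x)) has_real_derivative
      (log_L1 ?y)\<^sup>2 / ?y * (log_weight (Suc m) t / t)) (at t)"
    using DERIV_chain2[OF DERIV_log_L1[OF y] Suc.IH] .
  moreover have "log_L (Suc (Suc m)) = (\<lambda>x. log_L1 (log_L (Suc m) x))"
    by (simp add: fun_eq_iff log_L_Suc)
  moreover have "(log_L1 ?y)\<^sup>2 / ?y * (log_weight (Suc m) t / t) = log_weight (Suc (Suc m)) t / t"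
  proof -
    have "(\<Prod>k=1..Suc m. log_L k t) = (\<Prod>k=1..m. log_L k t) * ?y"
      by (simp add: prod.nat_ivl_Suc')
    then show ?thesis
      using y unfolding log_weight_def log_L_Suc[of "Suc m"]
      by (simp add: power2_eq_square del: prod.cl_ivl_Suc)
  qed
  ultimately show ?case by simp
qed

text \<open>Mean value theorem for the formula of \<open>DERIV_log_L\<close>: at the intermediate
  point the weight is at least its value at t, and the denominator is at most \<mu> t. The factor
  lost does not involve m, which is the source of the uniformity in m.\<close>

lemma log_L_dilation_increment:
  assumes "0 < t" "1 < \<mu>" "\<mu> * t < 1"
  shows "(\<mu> - 1) / \<mu> * log_weight (Suc m) t \<le> log_L (Suc m) (\<mu> * t) - log_L (Suc m) t"
proof -
  have lt: "t < \<mu> * t" using assms by simp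
  obtain z where z: "t < z" "z < \<mu> * t"
    "log_L (Suc m) (\<mu> * t) - log_L (Suc m) t = (\<mu> * t - t) * (log_weight (Suc m) z / z)"
    using MVT2[OF lt, of "log_L (Suc m)" "\<lambda>x. log_weight (Suc m) x / x"] DERIV_log_L assms
    by (metis (no_types, lifting) less_le_trans le_less_trans)
  have "log_weight (Suc m) t / (\<mu> * t) \<le> log_weight (Suc m) z / z"
    using z assms log_weight_mono[of t z "Suc m"] log_weight_pos[of z "Suc m"]
      log_weight_pos[of t "Suc m"]
    by (intro frac_le) auto
  then have "(\<mu> * t - t) * (log_weight (Suc m) t / (\<mu> * t)) \<le> (\<mu> * t - t) * (log_weight (Suc m) z / z)"
    using lt by (intro mult_left_mono) auto
  moreover have "(\<mu> * t - t) * (log_weight (Suc m) t / (\<mu> * t)) = (\<mu> - 1) / \<mu> * log_weight (Suc m) t"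
    using assms by (simp add: field_simps)
  ultimately show ?thesis using z(3) by simp
qed

lemma borel_measurable_log_L [measurable]: "log_L m \<in> borel_measurable borel"
proof (induction m)
  case 0
  have "log_L 0 = (\<lambda>t. t)" by auto
  then show ?case by simp
next
  case (Suc m)
  have "log_L (Suc m) = (\<lambda>t. 1 / (1 - ln (log_L m t)))"
    by (simp add: fun_eq_iff log_L_Suc log_L1_def)
  then show ?case using Suc by simp
qed

lemma borel_measurable_log_weight [measurable]: "log_weight m \<in> borel_measurable borel"
  unfolding log_weight_def[abs_def] by measurable

section \<open>Integration along lines\<close>

lemma nn_integral_lborel_affine:
  fixes f :: "'a::euclidean_space \<Rightarrow> ennreal"
  assumes [measurable]: "f \<in> borel_measurable borel" and "c \<noteq> 0"
  shows "(\<integral>\<^sup>+x. f x \<partial>lborel) = ennreal (\<bar>c\<bar> ^ DIM('a)) * (\<integral>\<^sup>+x. f (t + c *\<^sub>R x) \<partial>lborel)"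
  by (subst lborel_affine[OF \<open>c \<noteq> 0\<close>, of t])
     (simp add: nn_integral_density nn_integral_distr nn_integral_cmult)

lemma nn_integral_lborel_translate:
  fixes f :: "'a::euclidean_space \<Rightarrow> ennreal"
  assumes [measurable]: "f \<in> borel_measurable borel"
  shows "(\<integral>\<^sup>+x. f (x + t) \<partial>lborel) = (\<integral>\<^sup>+x. f x \<partial>lborel)"
  using nn_integral_lborel_affine[OF assms, of 1 t] by (simp add: add.commute)

text \<open>The slab \<open>0 \<le> \<eta> < 1\<close> serves as the space of lines parallel to \<open>\<nu>\<close>, so no rotation of
  the coordinates is needed.\<close>

lemma nn_integral_along_lines:
  fixes F :: "'a::euclidean_space \<Rightarrow> ennreal" and \<eta> :: "'a \<Rightarrow> real"
  assumes [measurable]: "F \<in> borel_measurable borel" "\<eta> \<in> borel_measurable borel"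
    and shift: "\<And>x t. \<eta> (x + t *\<^sub>R \<nu>) = \<eta> x + t"
  shows "(\<integral>\<^sup>+x. F x \<partial>lborel) =
    (\<integral>\<^sup>+x. indicator {x. 0 \<le> \<eta> x \<and> \<eta> x < 1} x * (\<integral>\<^sup>+t. F (x + t *\<^sub>R \<nu>) \<partial>lborel) \<partial>lborel)"
proof -
  \<comment> \<open>Each line parallel to \<nu> meets the slab in parameter length exactly 1;
    inserting this factor and exchanging the integrals gives the claim.\<close>
  have slab: "(\<integral>\<^sup>+t. indicator {0..<1} (\<eta> x - t) \<partial>lborel) = (1::ennreal)" for x
  proof -
    have "(\<integral>\<^sup>+t. indicator {0..<1} (\<eta> x - t) \<partial>lborel) = (\<integral>\<^sup>+t. indicator {\<eta> x - 1<..\<eta> x} t \<partial>lborel)"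
      by (intro nn_integral_cong) (auto split: split_indicator)
    then show ?thesis by simp
  qed
  have "(\<integral>\<^sup>+x. indicator {x. 0 \<le> \<eta> x \<and> \<eta> x < 1} x * (\<integral>\<^sup>+t. F (x + t *\<^sub>R \<nu>) \<partial>lborel) \<partial>lborel)
      = (\<integral>\<^sup>+x. (\<integral>\<^sup>+t. indicator {0..<1} (\<eta> x) * F (x + t *\<^sub>R \<nu>) \<partial>lborel) \<partial>lborel)"
    by (subst nn_integral_cmult) (auto intro!: nn_integral_cong split: split_indicator)
  also have "\<dots> = (\<integral>\<^sup>+t. (\<integral>\<^sup>+x. indicator {0..<1} (\<eta> x) * F (x + t *\<^sub>R \<nu>) \<partial>lborel) \<partial>lborel)"
    by (rule lborel_pair.Fubini') measurable
  also have "\<dots> = (\<integral>\<^sup>+t. (\<integral>\<^sup>+x. indicator {0..<1} (\<eta> x - t) * F x \<partial>lborel) \<partial>lborel)"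
  proof (rule nn_integral_cong)
    fix t :: real
    have "\<eta> (x + t *\<^sub>R \<nu>) - t = \<eta> x" for x using shift[of x t] by simp
    then show "(\<integral>\<^sup>+x. indicator {0..<1} (\<eta> x) * F (x + t *\<^sub>R \<nu>) \<partial>lborel)
        = (\<integral>\<^sup>+x. indicator {0..<1} (\<eta> x - t) * F x \<partial>lborel)"
      using nn_integral_lborel_translate[of "\<lambda>x. indicator {0..<1} (\<eta> x - t) * F x" "t *\<^sub>R \<nu>"]
      by simp
  qed
  also have "\<dots> = (\<integral>\<^sup>+x. (\<integral>\<^sup>+t. indicator {0..<1} (\<eta> x - t) * F x \<partial>lborel) \<partial>lborel)"
    by (rule lborel_pair.Fubini') measurable
  also have "\<dots> = (\<integral>\<^sup>+x. F x \<partial>lborel)"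
    by (subst nn_integral_multc) (auto simp: slab)
  finally show ?thesis by simp
qed

text \<open>On a line parallel to \<nu> the map is affine in the parameter with slope 1 + l, so the
  change of variables is one-dimensional. The height is merely Lipschitz in the application, and it
  enters without a derivative.\<close>

lemma nn_integral_line_dilation:
  fixes F :: "'a::euclidean_space \<Rightarrow> ennreal" and \<eta> :: "'a \<Rightarrow> real"
  assumes [measurable]: "F \<in> borel_measurable borel" "\<eta> \<in> borel_measurable borel"
    and shift: "\<And>x t. \<eta> (x + t *\<^sub>R \<nu>) = \<eta> x + t" and "0 < l"
  shows "(\<integral>\<^sup>+x. F x \<partial>lborel) = ennreal (1 + l) * (\<integral>\<^sup>+x. F (x + (l * \<eta> x) *\<^sub>R \<nu>) \<partial>lborel)"
proof -
  let ?S = "{x. 0 \<le> \<eta> x \<and> \<eta> x < 1}"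
  have line: "(\<integral>\<^sup>+t. F (x + t *\<^sub>R \<nu>) \<partial>lborel)
      = ennreal (1 + l) * (\<integral>\<^sup>+t. F (x + t *\<^sub>R \<nu> + (l * \<eta> (x + t *\<^sub>R \<nu>)) *\<^sub>R \<nu>) \<partial>lborel)" for x
  proof -
    have "x + (l * \<eta> x + (1 + l) *\<^sub>R t) *\<^sub>R \<nu> = x + t *\<^sub>R \<nu> + (l * \<eta> (x + t *\<^sub>R \<nu>)) *\<^sub>R \<nu>" for t
      by (simp add: shift algebra_simps)
    then show ?thesis
      using nn_integral_lborel_affine[of "\<lambda>t. F (x + t *\<^sub>R \<nu>)" "1 + l" "l * \<eta> x"] \<open>0 < l\<close>
      by (simp add: add.assoc)
  qed
  have "(\<integral>\<^sup>+x. F x \<partial>lborel) = (\<integral>\<^sup>+x. indicator ?S x * (\<integral>\<^sup>+t. F (x + t *\<^sub>R \<nu>) \<partial>lborel) \<partial>lborel)"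
    by (rule nn_integral_along_lines) (use shift in auto)
  also have "\<dots> = ennreal (1 + l) * (\<integral>\<^sup>+x. indicator ?S x *
      (\<integral>\<^sup>+t. F (x + t *\<^sub>R \<nu> + (l * \<eta> (x + t *\<^sub>R \<nu>)) *\<^sub>R \<nu>) \<partial>lborel) \<partial>lborel)"
    by (subst nn_integral_cmult[symmetric])
       (auto intro!: nn_integral_cong simp: line mult_ac)
  also have "(\<integral>\<^sup>+x. indicator ?S x *
      (\<integral>\<^sup>+t. F (x + t *\<^sub>R \<nu> + (l * \<eta> (x + t *\<^sub>R \<nu>)) *\<^sub>R \<nu>) \<partial>lborel) \<partial>lborel)
      = (\<integral>\<^sup>+x. F (x + (l * \<eta> x) *\<^sub>R \<nu>) \<partial>lborel)"
    by (rule nn_integral_along_lines[symmetric]) (use shift in auto)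
  finally show ?thesis .
qed

text \<open>A function of the height over a cylinder factors into cross-section and height integral.
  The measure of the cross-section is expressed as the volume of a slice of height 1.\<close>

lemma nn_integral_line_coarea:
  fixes f :: "real \<Rightarrow> ennreal" and \<eta> :: "'a::euclidean_space \<Rightarrow> real"
  assumes [measurable]: "f \<in> borel_measurable borel" "\<eta> \<in> borel_measurable borel" "Z \<in> sets borel"
    and shift: "\<And>x t. \<eta> (x + t *\<^sub>R \<nu>) = \<eta> x + t"
    and cyl: "\<And>x t. x + t *\<^sub>R \<nu> \<in> Z \<longleftrightarrow> x \<in> Z"
  shows "(\<integral>\<^sup>+x. indicator Z x * f (\<eta> x) \<partial>lborel) =
    emeasure lborel {x\<in>Z. 0 \<le> \<eta> x \<and> \<eta> x < 1} * (\<integral>\<^sup>+t. f t \<partial>lborel)"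
proof -
  let ?S = "{x. 0 \<le> \<eta> x \<and> \<eta> x < 1}"
  have line: "(\<integral>\<^sup>+t. indicator Z (x + t *\<^sub>R \<nu>) * f (\<eta> (x + t *\<^sub>R \<nu>)) \<partial>lborel)
      = indicator Z x * (\<integral>\<^sup>+t. f t \<partial>lborel)" for x
  proof -
    have "(\<integral>\<^sup>+t. indicator Z (x + t *\<^sub>R \<nu>) * f (\<eta> (x + t *\<^sub>R \<nu>)) \<partial>lborel)
        = (\<integral>\<^sup>+t. indicator Z x * f (t + \<eta> x) \<partial>lborel)"
      by (intro nn_integral_cong) (auto simp: shift cyl add.commute split: split_indicator)
    also have "\<dots> = indicator Z x * (\<integral>\<^sup>+t. f (t + \<eta> x) \<partial>lborel)"
      by (rule nn_integral_cmult) measurable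
    also have "(\<integral>\<^sup>+t. f (t + \<eta> x) \<partial>lborel) = (\<integral>\<^sup>+t. f t \<partial>lborel)"
      by (rule nn_integral_lborel_translate) measurable
    finally show ?thesis .
  qed
  have "(\<integral>\<^sup>+x. indicator Z x * f (\<eta> x) \<partial>lborel)
      = (\<integral>\<^sup>+x. indicator ?S x * (\<integral>\<^sup>+t. indicator Z (x + t *\<^sub>R \<nu>) * f (\<eta> (x + t *\<^sub>R \<nu>)) \<partial>lborel) \<partial>lborel)"
    by (rule nn_integral_along_lines) (use shift in auto)
  also have "\<dots> = (\<integral>\<^sup>+x. indicator {x\<in>Z. 0 \<le> \<eta> x \<and> \<eta> x < 1} x * (\<integral>\<^sup>+t. f t \<partial>lborel) \<partial>lborel)"
    by (intro nn_integral_cong) (auto simp: line split: split_indicator)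
  also have "\<dots> = emeasure lborel {x\<in>Z. 0 \<le> \<eta> x \<and> \<eta> x < 1} * (\<integral>\<^sup>+t. f t \<partial>lborel)"
    by (subst nn_integral_multc) auto
  finally show ?thesis .
qed

section \<open>Poincare inequality with the factor 1 - s\<close>

lemma sum_power_le_2_power:
  fixes b :: real
  assumes "2 \<le> b"
  shows "(\<Sum>k<Suc N. b ^ k) \<le> 2 * b ^ N"
proof (induction N)
  case (Suc N)
  have "2 * b ^ N \<le> b * b ^ N" using assms by (intro mult_right_mono) auto
  with Suc show ?case by simp
qed simp

text \<open>A geometric sum of ratio at least 2 is at most twice its largest term, and the terms
  present have 2^k \<le> X. With X = D / |p - q| the sum collects the scales D / 2^k that are still
  at least |p - q|.\<close>

lemma sum_dyadic_powers_le:
  fixes X a :: real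
  assumes "1 \<le> a" "0 < X"
  shows "(\<Sum>k<N. if 2 ^ k \<le> X then (2 powr a) ^ k else 0) \<le> 2 * X powr a"
proof (induction N)
  case (Suc N)
  have b: "2 \<le> 2 powr a" using powr_mono[of 1 a "2::real"] assms by simp
  show ?case
  proof (cases "2 ^ N \<le> X")
    case True
    have "(\<Sum>k<Suc N. if 2 ^ k \<le> X then (2 powr a) ^ k else 0) \<le> (\<Sum>k<Suc N. (2 powr a) ^ k)"
      by (intro sum_mono) auto
    also have "\<dots> \<le> 2 * (2 powr a) ^ N" by (rule sum_power_le_2_power[OF b])
    also have "(2 powr a) ^ N = (2 ^ N) powr a"
      by (simp add: powr_powr mult.commute flip: powr_realpow)
    also have "\<dots> \<le> X powr a" using True assms by (intro powr_mono2) auto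
    finally show ?thesis by simp
  qed (use Suc in simp)
qed simp

text \<open>Origin of the factor 1 - s: the series sums to 1 / (1 - r) with r = 2^(s-1), and r \<ge>
  1 + (s - 1) ln 2 \<ge> s because ln 2 < 1.\<close>

lemma geometric_gain:
  fixes s :: real
  assumes "s < 1"
  shows "ennreal 1 \<le> ennreal (1 - s) * (\<Sum>k. ennreal ((2 powr (s - 1)) ^ k))"
proof -
  let ?r = "2 powr (s - 1) :: real"
  have r: "0 < ?r" "?r < 1" using assms by (auto simp: powr_less_one)
  define x :: real where "x = (s - 1) * ln 2"
  have "(s - 1) * 1 \<le> x"
    unfolding x_def using assms ln_2_less_1 by (intro mult_left_mono_neg) auto
  then have "s \<le> 1 + x" by simp
  also have "\<dots> \<le> exp x" by (rule exp_ge_add_one_self)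
  finally have "s \<le> exp x" .
  then have "1 - ?r \<le> 1 - s" by (simp add: powr_def x_def)
  then have "1 \<le> (1 - s) * (1 / (1 - ?r))" using r by simp
  then have "ennreal 1 \<le> ennreal ((1 - s) * (1 / (1 - ?r)))" by (rule ennreal_leI)
  also have "\<dots> = ennreal (1 - s) * ennreal (1 / (1 - ?r))"
    using assms r by (intro ennreal_mult) auto
  also have "ennreal (1 / (1 - ?r)) = (\<Sum>k. ennreal (?r ^ k))"
    using r by (subst suminf_ennreal2) (auto intro!: summable_geometric simp: suminf_geometric)
  finally show ?thesis .
qed

text \<open>Passing through the midpoint of \<open>p\<close> and \<open>q\<close> halves the scale.\<close>

lemma oscillation_halving:
  fixes u :: "'a::euclidean_space \<Rightarrow> real"
  assumes [measurable]: "u \<in> borel_measurable borel" "Q \<in> sets borel" and "convex Q"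
  defines "G \<equiv> \<lambda>r. \<integral>\<^sup>+p. \<integral>\<^sup>+q. indicator Q p * (indicator Q q * (indicator {..r} (dist p q) *
      ennreal \<bar>u p - u q\<bar>)) \<partial>lborel \<partial>lborel"
  shows "G r \<le> 2 ^ (DIM('a) + 1) * G (r / 2)"
proof -
  define H where "H r p q = indicator Q p * (indicator Q q * (indicator {..r} (dist p q) *
      ennreal \<bar>u p - u q\<bar>))" for r and p q :: 'a
  have [measurable]: "(\<lambda>x. H r (f x) (g x)) \<in> borel_measurable M"
    if [measurable]: "f \<in> borel_measurable M" "g \<in> borel_measurable M" for r M f and g :: "_ \<Rightarrow> 'a"
    unfolding H_def by measurable
  have G: "G r = (\<integral>\<^sup>+p. \<integral>\<^sup>+q. H r p q \<partial>lborel \<partial>lborel)" for r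
    by (simp add: G_def H_def)
  define M where "M p q = (1/2) *\<^sub>R p + (1/2) *\<^sub>R q" for p q :: 'a
  have [measurable]: "(\<lambda>x. M (f x) (g x)) \<in> borel_measurable N"
    if [measurable]: "f \<in> borel_measurable N" "g \<in> borel_measurable N" for N f g
    unfolding M_def by measurable
  have step: "H r p q \<le> H (r/2) p (M p q) + H (r/2) q (M p q)" for p q
  proof (cases "p \<in> Q \<and> q \<in> Q \<and> dist p q \<le> r")
    case True
    have "M p q \<in> Q"
      unfolding M_def using True \<open>convex Q\<close> by (intro convexD) auto
    moreover have "dist p (M p q) = dist p q / 2" "dist q (M p q) = dist p q / 2"
    proof -
      have "p - M p q = (1/2) *\<^sub>R (p - q)" "q - M p q = (1/2) *\<^sub>R (q - p)"
        unfolding M_def by (simp_all add: algebra_simps flip: scaleR_add_left)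
      then show "dist p (M p q) = dist p q / 2" "dist q (M p q) = dist p q / 2"
        by (simp_all add: dist_norm norm_minus_commute)
    qed
    moreover have "ennreal \<bar>u p - u q\<bar> \<le> ennreal \<bar>u p - u (M p q)\<bar> + ennreal \<bar>u q - u (M p q)\<bar>"
      by (simp flip: ennreal_plus)
    ultimately show ?thesis using True by (simp add: H_def)
  next
    case False
    then have "H r p q = 0" by (auto simp: H_def split: split_indicator)
    then show ?thesis by simp
  qed
  \<comment> \<open>Moving q to the midpoint contracts by 1/2 and costs 2^d in the integral, d being
    the dimension; together with the symmetric half this produces the exponent d + 1.\<close>
  have half: "(\<integral>\<^sup>+q. H (r/2) p (M p q) \<partial>lborel) = ennreal (2 ^ DIM('a)) * (\<integral>\<^sup>+q. H (r/2) p q \<partial>lborel)" for p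
  proof -
    have "(\<integral>\<^sup>+q. H (r/2) p q \<partial>lborel)
        = ennreal ((1/2) ^ DIM('a)) * (\<integral>\<^sup>+q. H (r/2) p (M p q) \<partial>lborel)"
      unfolding M_def by (subst nn_integral_lborel_affine[of _ "1/2" "(1/2) *\<^sub>R p"]) auto
    then have "ennreal (2 ^ DIM('a)) * (\<integral>\<^sup>+q. H (r/2) p q \<partial>lborel)
        = ennreal (2 ^ DIM('a) * (1/2) ^ DIM('a)) * (\<integral>\<^sup>+q. H (r/2) p (M p q) \<partial>lborel)"
      by (subst ennreal_mult) (auto simp: mult.assoc)
    then show ?thesis by (simp flip: power_mult_distrib)
  qed
  have M_comm: "M p q = M q p" for p q by (simp add: M_def add.commute)
  have "G r \<le> (\<integral>\<^sup>+p. \<integral>\<^sup>+q. H (r/2) p (M p q) + H (r/2) q (M p q) \<partial>lborel \<partial>lborel)"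
    unfolding G by (intro nn_integral_mono step)
  also have "\<dots> = (\<integral>\<^sup>+p. \<integral>\<^sup>+q. H (r/2) p (M p q) \<partial>lborel \<partial>lborel)
      + (\<integral>\<^sup>+p. \<integral>\<^sup>+q. H (r/2) q (M p q) \<partial>lborel \<partial>lborel)"
    by (simp add: nn_integral_add)
  also have "(\<integral>\<^sup>+p. \<integral>\<^sup>+q. H (r/2) q (M p q) \<partial>lborel \<partial>lborel)
      = (\<integral>\<^sup>+q. \<integral>\<^sup>+p. H (r/2) q (M p q) \<partial>lborel \<partial>lborel)"
    by (rule lborel_pair.Fubini') measurable
  also have "\<dots> = (\<integral>\<^sup>+p. \<integral>\<^sup>+q. H (r/2) p (M p q) \<partial>lborel \<partial>lborel)"
    by (simp add: M_comm)
  also have "(\<integral>\<^sup>+p. \<integral>\<^sup>+q. H (r/2) p (M p q) \<partial>lborel \<partial>lborel) = ennreal (2 ^ DIM('a)) * G (r/2)"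
    unfolding G half by (rule nn_integral_cmult) measurable
  also have "ennreal (2 ^ DIM('a)) * G (r/2) + ennreal (2 ^ DIM('a)) * G (r/2)
      = 2 ^ (DIM('a) + 1) * G (r / 2)"
    by (simp add: ennreal_power[symmetric] mult.assoc flip: mult_2)
  finally show ?thesis .
qed

text \<open>The factor \<open>1 - s\<close> is gained by summing over the dyadic scales \<open>D / 2 ^ k\<close>: each of them
  bounds the oscillation at scale \<open>D\<close> with the geometric weight \<open>2 powr (k * (s - 1))\<close>.\<close>

lemma fractional_Poincare_convex:
  fixes u :: "'a::euclidean_space \<Rightarrow> real" and s :: real
  assumes [measurable]: "u \<in> borel_measurable borel" "Q \<in> sets borel" and "convex Q"
    and diam: "\<And>p q. p \<in> Q \<Longrightarrow> q \<in> Q \<Longrightarrow> dist p q \<le> D" and "0 < D" and s: "0 \<le> s" "s < 1"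
  shows "(\<integral>\<^sup>+p. \<integral>\<^sup>+q. indicator Q p * (indicator Q q * ennreal \<bar>u p - u q\<bar>) \<partial>lborel \<partial>lborel)
    \<le> ennreal (2 * (1 - s) * D powr (real DIM('a) + s)) *
      (\<integral>\<^sup>+p. \<integral>\<^sup>+q. indicator Q p * (indicator Q q *
        ennreal (\<bar>u p - u q\<bar> / norm (p - q) powr (real DIM('a) + s))) \<partial>lborel \<partial>lborel)"
proof -
  let ?a = "real DIM('a) + s"
  let ?b = "2 powr ?a :: real"
  define H where "H r p q = indicator Q p * (indicator Q q * (indicator {..r} (dist p q) *
      ennreal \<bar>u p - u q\<bar>))" for r and p q :: 'a
  have H_meas[measurable]: "(\<lambda>x. H r (f x) (g x)) \<in> borel_measurable M"
    if [measurable]: "f \<in> borel_measurable M" "g \<in> borel_measurable M" for r M f and g :: "_ \<Rightarrow> 'a"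
    unfolding H_def by measurable
  define G where "G r = (\<integral>\<^sup>+p. \<integral>\<^sup>+q. H r p q \<partial>lborel \<partial>lborel)" for r
  define S where "S = (\<integral>\<^sup>+p. \<integral>\<^sup>+q. indicator Q p * (indicator Q q *
        ennreal (\<bar>u p - u q\<bar> / norm (p - q) powr ?a)) \<partial>lborel \<partial>lborel)"
  have G0: "(\<integral>\<^sup>+p. \<integral>\<^sup>+q. indicator Q p * (indicator Q q * ennreal \<bar>u p - u q\<bar>) \<partial>lborel \<partial>lborel) = G D"
    unfolding G_def H_def by (intro nn_integral_cong) (auto simp: diam split: split_indicator)
  have pow2: "(2::ennreal) ^ n = ennreal (2 ^ n)" for n
    by (simp flip: ennreal_power)
  have chain: "G D \<le> ennreal (2 ^ ((DIM('a) + 1) * k)) * G (D / 2 ^ k)" for k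
  proof (induction k)
    case (Suc k)
    have "G (D / 2 ^ k) \<le> 2 ^ (DIM('a) + 1) * G (D / 2 ^ k / 2)"
      unfolding G_def H_def by (rule oscillation_halving) fact+
    then have "ennreal (2 ^ ((DIM('a) + 1) * k)) * G (D / 2 ^ k)
       \<le> ennreal (2 ^ ((DIM('a) + 1) * k)) * (ennreal (2 ^ (DIM('a) + 1)) * G (D / 2 ^ Suc k))"
      unfolding pow2 by (intro mult_left_mono) (auto simp: mult.commute)
    also have "\<dots> = ennreal (2 ^ ((DIM('a) + 1) * Suc k)) * G (D / 2 ^ Suc k)"
      by (simp add: ennreal_mult'[symmetric] mult.assoc[symmetric] power_add[symmetric] algebra_simps)
    finally show ?case using Suc by (rule order_trans[rotated])
  qed simp
  \<comment> \<open>k halvings cost 2^((d+1)k). The weight 2^((s-1)k) lowers this to 2^((d+s)k), the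
    size of the kernel |p - q|^(-d-s) at scale 2^(-k).\<close>
  have scale: "ennreal ((2 powr (s - 1)) ^ k) * G D \<le> ennreal (?b ^ k) * G (D / 2 ^ k)" for k
  proof -
    have "ennreal ((2 powr (s - 1)) ^ k) * G D
        \<le> ennreal ((2 powr (s - 1)) ^ k) * (ennreal (2 ^ ((DIM('a) + 1) * k)) * G (D / 2 ^ k))"
      by (intro mult_left_mono chain) simp
    also have "\<dots> = ennreal ((2 powr (s - 1)) ^ k * (2 ^ (DIM('a) + 1)) ^ k) * G (D / 2 ^ k)"
      by (subst power_mult, subst ennreal_mult) (simp_all only: mult.assoc zero_le_power powr_ge_zero zero_le_numeral)
    also have "(2 powr (s - 1)) ^ k * (2 ^ (DIM('a) + 1)) ^ k = ?b ^ k"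
    proof -
      have "?b = 2 powr (s - 1) * 2 powr real (DIM('a) + 1)"
        unfolding powr_add[symmetric] by (simp add: algebra_simps)
      also have "2 powr real (DIM('a) + 1) = (2::real) ^ (DIM('a) + 1)"
        by (rule powr_realpow) simp
      finally have "?b ^ k = (2 powr (s - 1) * 2 ^ (DIM('a) + 1)) ^ k" by (rule arg_cong)
      then show ?thesis unfolding power_mult_distrib by (rule sym)
    qed
    finally show ?thesis .
  qed
  \<comment> \<open>A pair contributes only at the scales D / 2^k \<ge> |p - q|, and the weights of
    these scales sum to at most 2 (D / |p - q|)^(d+s).\<close>
  have point: "(\<Sum>k. ennreal (?b ^ k) * H (D / 2 ^ k) p q) \<le>
      ennreal (2 * D powr ?a) * (indicator Q p * (indicator Q q *
        ennreal (\<bar>u p - u q\<bar> / norm (p - q) powr ?a)))" for p q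
  proof (cases "p \<in> Q \<and> q \<in> Q \<and> p \<noteq> q")
    case True
    let ?X = "D / dist p q"
    have X: "0 < ?X" "0 < dist p q" using True \<open>0 < D\<close> by auto
    have summand: "ennreal (?b ^ k) * H (D / 2 ^ k) p q =
        ennreal ((if 2 ^ k \<le> ?X then ?b ^ k else 0) * \<bar>u p - u q\<bar>)" for k
    proof -
      have "2 ^ k \<le> ?X \<longleftrightarrow> dist p q \<le> D / 2 ^ k"
        using X(2) by (simp add: pos_le_divide_eq mult.commute)
      moreover have "ennreal (?b ^ k * \<bar>u p - u q\<bar>) = ennreal (?b ^ k) * ennreal \<bar>u p - u q\<bar>"
        by (rule ennreal_mult) auto
      ultimately show ?thesis
        unfolding H_def using True by (cases "dist p q \<le> D / 2 ^ k") simp_all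
    qed
    have "(\<Sum>k. ennreal (?b ^ k) * H (D / 2 ^ k) p q) \<le> ennreal (2 * ?X powr ?a * \<bar>u p - u q\<bar>)"
    proof (rule suminf_le_const[OF summableI])
      fix N
      have "(\<Sum>k<N. ennreal (?b ^ k) * H (D / 2 ^ k) p q)
          = ennreal ((\<Sum>k<N. if 2 ^ k \<le> ?X then ?b ^ k else 0) * \<bar>u p - u q\<bar>)"
        unfolding summand sum_distrib_right by (rule sum_ennreal) auto
      also have "\<dots> \<le> ennreal (2 * ?X powr ?a * \<bar>u p - u q\<bar>)"
        using sum_dyadic_powers_le[OF _ X(1), of ?a N] s DIM_positive[where 'a='a]
        by (intro ennreal_leI mult_right_mono) auto
      finally show "(\<Sum>k<N. ennreal (?b ^ k) * H (D / 2 ^ k) p q) \<le> \<dots>" .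
    qed
    also have "2 * ?X powr ?a * \<bar>u p - u q\<bar>
        = 2 * D powr ?a * (\<bar>u p - u q\<bar> / norm (p - q) powr ?a)"
      using \<open>0 < D\<close> by (simp add: powr_divide dist_norm)
    also have "ennreal (2 * D powr ?a * (\<bar>u p - u q\<bar> / norm (p - q) powr ?a))
        = ennreal (2 * D powr ?a) * ennreal (\<bar>u p - u q\<bar> / norm (p - q) powr ?a)"
      by (rule ennreal_mult) auto
    finally show ?thesis using True by (simp only: indicator_simps mult_1)
  next
    case False
    then have "H r p q = 0" for r by (auto simp: H_def split: split_indicator)
    then show ?thesis by simp
  qed
  have "G D \<le> ennreal (1 - s) * (\<Sum>k. ennreal ((2 powr (s - 1)) ^ k)) * G D"
    using mult_right_mono[OF geometric_gain[OF s(2)], of "G D"]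
    by (simp only: ennreal_1 mult_1_left zero_le)
  also have "\<dots> = ennreal (1 - s) * (\<Sum>k. ennreal ((2 powr (s - 1)) ^ k) * G D)"
    by (simp only: mult.assoc ennreal_suminf_multc)
  also have "\<dots> \<le> ennreal (1 - s) * (\<Sum>k. ennreal (?b ^ k) * G (D / 2 ^ k))"
    by (intro mult_left_mono suminf_le scale summableI) auto
  also have "(\<Sum>k. ennreal (?b ^ k) * G (D / 2 ^ k))
      = (\<integral>\<^sup>+p. \<integral>\<^sup>+q. (\<Sum>k. ennreal (?b ^ k) * H (D / 2 ^ k) p q) \<partial>lborel \<partial>lborel)"
    unfolding G_def by (simp add: nn_integral_suminf nn_integral_cmult)
  also have "\<dots> \<le> (\<integral>\<^sup>+p. \<integral>\<^sup>+q. ennreal (2 * D powr ?a) * (indicator Q p * (indicator Q q *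
        ennreal (\<bar>u p - u q\<bar> / norm (p - q) powr ?a))) \<partial>lborel \<partial>lborel)"
    by (intro nn_integral_mono point)
  also have "\<dots> = ennreal (2 * D powr ?a) * S"
    unfolding S_def by (simp add: nn_integral_cmult)
  finally have "G D \<le> ennreal (1 - s) * (ennreal (2 * D powr ?a) * S)"
    by (meson mult_left_mono zero_le)
  also have "\<dots> = ennreal (2 * (1 - s) * D powr ?a) * S"
  proof -
    have "2 * (1 - s) * D powr ?a = (1 - s) * (2 * D powr ?a)" by simp
    also have "ennreal \<dots> = ennreal (1 - s) * ennreal (2 * D powr ?a)"
      using s by (intro ennreal_mult) auto
    finally show ?thesis by (simp only: mult.assoc)
  qed
  finally show ?thesis unfolding G0 S_def .
qed

section \<open>Oscillation at the scale of the distance to the boundary\<close>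

text \<open>Where \<delta> is positive this is, up to a dimensional constant, \<delta>(x)^(-s) times
  the mean of |u x - u q| over the ball of radius \<delta>(x)/8.\<close>

definition oscillation ::
    "('a::euclidean_space \<Rightarrow> real) \<Rightarrow> real \<Rightarrow> ('a \<Rightarrow> real) \<Rightarrow> 'a \<Rightarrow> ennreal" where
  "oscillation \<delta> s u x = (\<integral>\<^sup>+q. (if dist x q < \<delta> x / 8
      then ennreal (\<delta> x powr -(real DIM('a) + s) * \<bar>u x - u q\<bar>) else 0) \<partial>lborel)"

text \<open>The seminorm for Borel functions, written over \<open>lborel\<close> with indicators so
  that Fubini applies on the whole space.\<close>

definition gagliardo :: "'a::euclidean_space set \<Rightarrow> real \<Rightarrow> ('a \<Rightarrow> real) \<Rightarrow> ennreal" where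
  "gagliardo \<Omega> s u = (\<integral>\<^sup>+p. \<integral>\<^sup>+q. indicator \<Omega> p * (indicator \<Omega> q *
      ennreal (\<bar>u p - u q\<bar> / norm (p - q) powr (real DIM('a) + s))) \<partial>lborel \<partial>lborel)"

lemma borel_measurable_oscillation [measurable]:
  assumes [measurable]: "\<delta> \<in> borel_measurable borel" "u \<in> borel_measurable borel"
  shows "oscillation \<delta> s u \<in> borel_measurable borel"
  unfolding oscillation_def[abs_def] by measurable

lemma powr_minus_comparable:
  fixes a b e :: real
  assumes "0 < b" "b \<le> 2 * a" "0 \<le> e"
  shows "a powr -e \<le> 2 powr e * b powr -e"
proof -
  have "(2 * a) powr -e \<le> b powr -e"
    using assms by (intro powr_mono2') auto
  then have "2 powr e * (2 * a) powr -e \<le> 2 powr e * b powr -e"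
    by (intro mult_left_mono) auto
  moreover have "2 powr e * (2 * a) powr -e = a powr -e"
    using assms by (simp add: powr_mult powr_minus)
  ultimately show ?thesis by simp
qed

lemma nn_integral_cmult_2:
  assumes [measurable]: "case_prod f \<in> borel_measurable (lborel \<Otimes>\<^sub>M lborel)"
  shows "(\<integral>\<^sup>+x. \<integral>\<^sup>+y. c * f x y \<partial>lborel \<partial>lborel) = c * (\<integral>\<^sup>+x. \<integral>\<^sup>+y. f x y \<partial>lborel \<partial>lborel)"
  by (simp add: nn_integral_cmult)

lemma ennreal_mult_3:
  "0 \<le> a \<Longrightarrow> 0 \<le> b \<Longrightarrow> 0 \<le> c \<Longrightarrow> ennreal a * (ennreal b * ennreal c) = ennreal (a * (b * c))"
  by (simp add: ennreal_mult)

text \<open>Averaging over centres \<open>z\<close> replaces the balls around \<open>x\<close>, on which only differences to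
  the centre occur, by balls to which the convex Poincare inequality applies.\<close>

lemma nn_integral_oscillation_le:
  fixes \<delta> u :: "'a::euclidean_space \<Rightarrow> real" and s :: real
  assumes [measurable]: "\<Omega> \<in> sets borel" "\<delta> \<in> borel_measurable borel" "u \<in> borel_measurable borel"
    and pos: "\<And>x. x \<in> \<Omega> \<Longrightarrow> 0 < \<delta> x"
    and lip: "\<And>x y. \<delta> x \<le> \<delta> y + dist x y"
    and sub: "\<And>x. x \<in> \<Omega> \<Longrightarrow> ball x (\<delta> x) \<subseteq> \<Omega>"
    and s: "0 \<le> s" "s < 1"
  shows "(\<integral>\<^sup>+x. indicator \<Omega> x * oscillation \<delta> s u x \<partial>lborel)
    \<le> ennreal (4 * 64 ^ DIM('a) * (1 - s)) * gagliardo \<Omega> s u"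
proof -
  let ?d = "real DIM('a)"
  define v where "v = unit_ball_vol ?d"
  have v: "0 < v" by (simp add: v_def)
  define k where "k p q = ennreal (\<bar>u p - u q\<bar> / norm (p - q) powr (?d + s))" for p q
  have [measurable]: "(\<lambda>x. k (f x) (g x)) \<in> borel_measurable M"
    if [measurable]: "f \<in> borel_measurable M" "g \<in> borel_measurable M" for M f and g :: "_ \<Rightarrow> 'a"
    unfolding k_def by measurable
  \<comment> \<open>The extra variable z is a centre near x, and the volume of its range is
    compensated by a further factor \<delta>^(-d). \<open>K1\<close> is anchored at x,
    \<open>K2\<close> at z with a larger ball, and \<open>K3\<close> is what \<open>K2\<close>
    becomes after the Poincare inequality on that ball.\<close>
  define K1 where "K1 x z q = (if x \<in> \<Omega> \<and> dist x z < \<delta> x / 8 \<and> dist x q < \<delta> x / 8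
      then ennreal (\<delta> x powr -(2 * ?d + s) * \<bar>u x - u q\<bar>) else 0)" for x z q
  define K2 where "K2 z x q = (if z \<in> \<Omega> \<and> dist z x < \<delta> z / 2 \<and> dist z q < \<delta> z / 2
      then ennreal (\<delta> z powr -(2 * ?d + s) * \<bar>u x - u q\<bar>) else 0)" for x z q
  define K3 where "K3 z x q = (if z \<in> \<Omega> \<and> dist z x < \<delta> z / 2 \<and> dist z q < \<delta> z / 2
      then ennreal (\<delta> z powr -?d) * k x q else 0)" for x z q
  have ball: "emeasure lborel (ball x r) = ennreal (v * r ^ DIM('a))" if "0 \<le> r" for x :: 'a and r
    unfolding v_def using that by (rule emeasure_ball)
  have balli: "(\<integral>\<^sup>+z. (if dist x z < r then c else 0) \<partial>lborel) = c * ennreal (v * r ^ DIM('a))"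
    if "0 \<le> r" for x :: 'a and r c
  proof -
    have "(\<integral>\<^sup>+z. (if dist x z < r then c else 0) \<partial>lborel) = (\<integral>\<^sup>+z. c * indicator (ball x r) z \<partial>lborel)"
      by (intro nn_integral_cong) (auto split: split_indicator)
    then show ?thesis using ball[OF that] by (simp add: nn_integral_cmult_indicator)
  qed
  have osc: "indicator \<Omega> x * oscillation \<delta> s u x
      = ennreal (8 ^ DIM('a) / v) * (\<integral>\<^sup>+z. \<integral>\<^sup>+q. K1 x z q \<partial>lborel \<partial>lborel)" for x
  proof (cases "x \<in> \<Omega>")
    case True
    note p = pos[OF True]
    define B where "B = (\<integral>\<^sup>+q. (if dist x q < \<delta> x / 8 then ennreal \<bar>u x - u q\<bar> else 0) \<partial>lborel)"
    have o: "oscillation \<delta> s u x = ennreal (\<delta> x powr -(?d + s)) * B"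
      unfolding oscillation_def B_def
      by (subst nn_integral_cmult[symmetric]) (auto intro!: nn_integral_cong simp: ennreal_mult)
    have "(\<integral>\<^sup>+q. K1 x z q \<partial>lborel)
        = (if dist x z < \<delta> x / 8 then ennreal (\<delta> x powr -(2 * ?d + s)) * B else 0)" for z
    proof (cases "dist x z < \<delta> x / 8")
      case near: True
      have "(\<integral>\<^sup>+q. K1 x z q \<partial>lborel) = ennreal (\<delta> x powr -(2 * ?d + s)) * B"
        unfolding K1_def B_def using True near
        by (subst nn_integral_cmult[symmetric]) (auto intro!: nn_integral_cong simp: ennreal_mult)
      then show ?thesis using near by simp
    next
      case False
      then show ?thesis by (simp add: K1_def)
    qed
    then have "(\<integral>\<^sup>+z. \<integral>\<^sup>+q. K1 x z q \<partial>lborel \<partial>lborel)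
        = ennreal (\<delta> x powr -(2 * ?d + s)) * B * ennreal (v * (\<delta> x / 8) ^ DIM('a))"
      using balli[of "\<delta> x / 8" x "ennreal (\<delta> x powr -(2 * ?d + s)) * B"] p by simp
    then have "ennreal (8 ^ DIM('a) / v) * (\<integral>\<^sup>+z. \<integral>\<^sup>+q. K1 x z q \<partial>lborel \<partial>lborel)
       = ennreal (8 ^ DIM('a) / v) * (ennreal (\<delta> x powr -(2 * ?d + s)) *
          ennreal (v * (\<delta> x / 8) ^ DIM('a))) * B"
      by (simp only: mult_ac)
    also have "ennreal (8 ^ DIM('a) / v) * (ennreal (\<delta> x powr -(2 * ?d + s)) *
          ennreal (v * (\<delta> x / 8) ^ DIM('a)))
        = ennreal (8 ^ DIM('a) / v * (\<delta> x powr -(2 * ?d + s) * (v * (\<delta> x / 8) ^ DIM('a))))"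
      using v p by (intro ennreal_mult_3) auto
    also have "8 ^ DIM('a) / v * (\<delta> x powr -(2 * ?d + s) * (v * (\<delta> x / 8) ^ DIM('a)))
        = \<delta> x powr -(?d + s)"
    proof -
      have e: "(\<delta> x) ^ DIM('a) = \<delta> x powr ?d" using p by (simp add: powr_realpow)
      have "\<delta> x powr -(2 * ?d + s) * \<delta> x powr ?d = \<delta> x powr -(?d + s)"
        unfolding powr_add[symmetric] by simp
      then show ?thesis using v by (simp add: power_divide e)
    qed
    finally show ?thesis using True o by simp
  next
    case False
    then show ?thesis by (simp add: K1_def)
  qed
  have K12: "K1 x z q \<le> ennreal (2 * 4 ^ DIM('a)) * K2 z x q" for x z q
  proof (cases "x \<in> \<Omega> \<and> dist x z < \<delta> x / 8 \<and> dist x q < \<delta> x / 8")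
    case True
    note p = pos[of x]
    have "z \<in> \<Omega>" using True sub[of x] p by (auto simp: subset_iff)
    have z: "\<delta> x \<le> \<delta> z + dist x z" "\<delta> z \<le> \<delta> x + dist x z"
      using lip[of x z] lip[of z x] by (auto simp: dist_commute)
    \<comment> \<open>Here |z - q| < \<delta>(x)/4 whereas \<delta>(z) > 7 \<delta>(x)/8, so the
      radius \<delta>(z)/2 is large enough.\<close>
    have "dist z q \<le> dist x z + dist x q" by metric
    then have near: "dist z x < \<delta> z / 2" "dist z q < \<delta> z / 2"
      using True z p by (auto simp: dist_commute)
    have "\<delta> x powr -(2 * ?d + s) \<le> 2 powr (2 * ?d + s) * \<delta> z powr -(2 * ?d + s)"
      using z True pos[OF \<open>z \<in> \<Omega>\<close>] s by (intro powr_minus_comparable) auto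
    also have "\<dots> \<le> (2 * 4 ^ DIM('a)) * \<delta> z powr -(2 * ?d + s)"
    proof (intro mult_right_mono)
      have "2 powr (2 * ?d + s) \<le> 2 powr (real (2 * DIM('a) + 1))"
        using s by (intro powr_mono) auto
      also have "\<dots> = 2 ^ (2 * DIM('a) + 1)" by (rule powr_realpow) simp
      also have "\<dots> = 2 * 4 ^ DIM('a)" by (simp add: power_mult)
      finally show "2 powr (2 * ?d + s) \<le> 2 * 4 ^ DIM('a)" .
    qed simp
    finally have "\<delta> x powr -(2 * ?d + s) * \<bar>u x - u q\<bar>
        \<le> (2 * 4 ^ DIM('a)) * (\<delta> z powr -(2 * ?d + s) * \<bar>u x - u q\<bar>)"
      by (simp add: mult_right_mono flip: mult.assoc)
    then have "ennreal (\<delta> x powr -(2 * ?d + s) * \<bar>u x - u q\<bar>)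
        \<le> ennreal ((2 * 4 ^ DIM('a)) * (\<delta> z powr -(2 * ?d + s) * \<bar>u x - u q\<bar>))"
      by (rule ennreal_leI)
    also have "\<dots> = ennreal (2 * 4 ^ DIM('a)) * ennreal (\<delta> z powr -(2 * ?d + s) * \<bar>u x - u q\<bar>)"
      by (rule ennreal_mult) auto
    finally show ?thesis using True near \<open>z \<in> \<Omega>\<close> by (simp only: K1_def K2_def if_True simp_thms)
  next
    case False
    then have "K1 x z q = 0" by (simp only: K1_def if_False)
    then show ?thesis by simp
  qed
  \<comment> \<open>The ball of radius \<delta>(z)/2 has diameter at most \<delta>(z), so the
    Poincare inequality contributes \<delta>(z)^(d+s) and leaves \<delta>(z)^(-d).\<close>
  have K23: "(\<integral>\<^sup>+x. \<integral>\<^sup>+q. K2 z x q \<partial>lborel \<partial>lborel)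
      \<le> ennreal (2 * (1 - s)) * (\<integral>\<^sup>+x. \<integral>\<^sup>+q. K3 z x q \<partial>lborel \<partial>lborel)" for z
  proof (cases "z \<in> \<Omega>")
    case True
    note p = pos[OF True]
    let ?B = "ball z (\<delta> z / 2)"
    have [measurable]: "?B \<in> sets borel" by simp
    have "(\<integral>\<^sup>+x. \<integral>\<^sup>+q. K2 z x q \<partial>lborel \<partial>lborel) = ennreal (\<delta> z powr -(2 * ?d + s)) *
       (\<integral>\<^sup>+x. \<integral>\<^sup>+q. indicator ?B x * (indicator ?B q * ennreal \<bar>u x - u q\<bar>) \<partial>lborel \<partial>lborel)"
      using True unfolding K2_def
      by (intro trans[OF _ nn_integral_cmult_2] nn_integral_cong)
         (auto simp: ennreal_mult split: split_indicator)
    also have "\<dots> \<le> ennreal (\<delta> z powr -(2 * ?d + s)) *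
        (ennreal (2 * (1 - s) * \<delta> z powr (?d + s)) *
         (\<integral>\<^sup>+x. \<integral>\<^sup>+q. indicator ?B x * (indicator ?B q * k x q) \<partial>lborel \<partial>lborel))"
      unfolding k_def
    proof (intro mult_left_mono fractional_Poincare_convex)
      fix a b assume "a \<in> ?B" "b \<in> ?B"
      then show "dist a b \<le> \<delta> z" using dist_triangle[of a b z] by (auto simp: dist_commute)
    qed (use s p in auto)
    also have "\<dots> = ennreal (2 * (1 - s)) * (ennreal (\<delta> z powr -?d) *
         (\<integral>\<^sup>+x. \<integral>\<^sup>+q. indicator ?B x * (indicator ?B q * k x q) \<partial>lborel \<partial>lborel))"
    proof -
      have "\<delta> z powr -(2 * ?d + s) * \<delta> z powr (?d + s) = \<delta> z powr -?d"
        unfolding powr_add[symmetric] by simp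
      then have e1: "\<delta> z powr -(2 * ?d + s) * (2 * (1 - s) * \<delta> z powr (?d + s)) = 2 * (1 - s) * \<delta> z powr -?d"
        by (simp add: mult_ac)
      have e2: "ennreal (2 * (1 - s) * \<delta> z powr -?d) = ennreal (2 * (1 - s)) * ennreal (\<delta> z powr -?d)"
        using s by (intro ennreal_mult) auto
      have e3: "ennreal (\<delta> z powr -(2 * ?d + s) * (2 * (1 - s) * \<delta> z powr (?d + s)))
          = ennreal (\<delta> z powr -(2 * ?d + s)) * ennreal (2 * (1 - s) * \<delta> z powr (?d + s))"
        using s by (intro ennreal_mult) auto
      show ?thesis
        by (subst mult.assoc[symmetric], subst e3[symmetric], subst e1, subst e2, rule mult.assoc)
    qed
    also have "ennreal (\<delta> z powr -?d) *
         (\<integral>\<^sup>+x. \<integral>\<^sup>+q. indicator ?B x * (indicator ?B q * k x q) \<partial>lborel \<partial>lborel)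
         = (\<integral>\<^sup>+x. \<integral>\<^sup>+q. K3 z x q \<partial>lborel \<partial>lborel)"
      using True unfolding K3_def
      by (intro trans[OF nn_integral_cmult_2[symmetric]] nn_integral_cong)
         (auto split: split_indicator)
    finally show ?thesis .
  next
    case False
    then show ?thesis by (simp add: K2_def)
  qed
  \<comment> \<open>For given x the admissible z lie within \<delta>(x) of x and satisfy \<delta>(x)
    \<le> 2 \<delta>(z); hence the volume of their range cancels \<delta>(z)^(-d) up to a constant,
    and the extra variable disappears.\<close>
  have K3: "(\<integral>\<^sup>+z. K3 z x q \<partial>lborel)
      \<le> ennreal (v * 2 ^ DIM('a)) * (indicator \<Omega> x * (indicator \<Omega> q * k x q))" for x q
  proof -
    have "K3 z x q \<le> (if dist x z < \<delta> x then ennreal (2 ^ DIM('a) * \<delta> x powr -?d) *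
        (indicator \<Omega> x * (indicator \<Omega> q * k x q)) else 0)" for z
    proof (cases "z \<in> \<Omega> \<and> dist z x < \<delta> z / 2 \<and> dist z q < \<delta> z / 2")
      case True
      note p = pos[of z]
      have "x \<in> \<Omega>" "q \<in> \<Omega>" using True sub[of z] p by (auto simp: subset_iff)
      have z: "\<delta> x \<le> \<delta> z + dist x z" "\<delta> z \<le> \<delta> x + dist x z"
        using lip[of x z] lip[of z x] by (auto simp: dist_commute)
      have near: "dist x z < \<delta> x" using z True by (simp add: dist_commute)
      have "\<delta> z powr -?d \<le> 2 powr ?d * \<delta> x powr -?d"
        using z True pos[OF \<open>x \<in> \<Omega>\<close>] by (intro powr_minus_comparable) (auto simp: dist_commute)
      then have "ennreal (\<delta> z powr -?d) \<le> ennreal (2 ^ DIM('a) * \<delta> x powr -?d)"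
        by (intro ennreal_leI) (simp add: powr_realpow)
      then show ?thesis
        using True near \<open>x \<in> \<Omega>\<close> \<open>q \<in> \<Omega>\<close> by (simp add: K3_def mult_right_mono)
    next
      case False
      then have "K3 z x q = 0" by (simp only: K3_def if_False)
      then show ?thesis by simp
    qed
    then have "(\<integral>\<^sup>+z. K3 z x q \<partial>lborel) \<le> (\<integral>\<^sup>+z. (if dist x z < \<delta> x
        then ennreal (2 ^ DIM('a) * \<delta> x powr -?d) * (indicator \<Omega> x * (indicator \<Omega> q * k x q))
        else 0) \<partial>lborel)"
      by (rule nn_integral_mono)
    also have "\<dots> \<le> ennreal (v * 2 ^ DIM('a)) * (indicator \<Omega> x * (indicator \<Omega> q * k x q))"
    proof (cases "x \<in> \<Omega>")
      case True
      note p = pos[OF True]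
      have "ennreal (2 ^ DIM('a) * \<delta> x powr -?d) * ennreal (v * \<delta> x ^ DIM('a))
          = ennreal (2 ^ DIM('a) * \<delta> x powr -?d * (v * \<delta> x ^ DIM('a)))"
        using p v by (intro ennreal_mult[symmetric]) auto
      also have "2 ^ DIM('a) * \<delta> x powr -?d * (v * \<delta> x ^ DIM('a)) = v * 2 ^ DIM('a)"
        using p by (simp add: powr_minus powr_realpow)
      finally have e: "ennreal (2 ^ DIM('a) * \<delta> x powr -?d) * ennreal (v * \<delta> x ^ DIM('a))
          = ennreal (v * 2 ^ DIM('a))" .
      have "ennreal (2 ^ DIM('a) * \<delta> x powr -?d) * X * ennreal (v * \<delta> x ^ DIM('a))
          = ennreal (v * 2 ^ DIM('a)) * X" for X
        unfolding e[symmetric] by (simp only: mult_ac)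
      then show ?thesis
        using p by (subst balli) auto
    qed (simp cong: if_cong)
    finally show ?thesis .
  qed
  have meas [measurable]:
    "(\<lambda>x. K1 (f x) (g x) (h x)) \<in> borel_measurable M"
    "(\<lambda>x. K2 (f x) (g x) (h x)) \<in> borel_measurable M"
    "(\<lambda>x. K3 (f x) (g x) (h x)) \<in> borel_measurable M"
    if [measurable]: "f \<in> borel_measurable M" "g \<in> borel_measurable M" "h \<in> borel_measurable M"
    for M f and g h :: "_ \<Rightarrow> 'a"
    unfolding K1_def K2_def K3_def by measurable
  let ?c1 = "ennreal (8 ^ DIM('a) / v)" and ?c2 = "ennreal (2 * 4 ^ DIM('a))"
    and ?c3 = "ennreal (2 * (1 - s))" and ?c4 = "ennreal (v * 2 ^ DIM('a))"
  have "(\<integral>\<^sup>+x. indicator \<Omega> x * oscillation \<delta> s u x \<partial>lborel)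
      = ?c1 * (\<integral>\<^sup>+x. \<integral>\<^sup>+z. \<integral>\<^sup>+q. K1 x z q \<partial>lborel \<partial>lborel \<partial>lborel)"
    unfolding osc by (rule nn_integral_cmult) measurable
  also have "(\<integral>\<^sup>+x. \<integral>\<^sup>+z. \<integral>\<^sup>+q. K1 x z q \<partial>lborel \<partial>lborel \<partial>lborel)
      \<le> (\<integral>\<^sup>+x. \<integral>\<^sup>+z. \<integral>\<^sup>+q. ?c2 * K2 z x q \<partial>lborel \<partial>lborel \<partial>lborel)"
    by (intro nn_integral_mono K12)
  also have "\<dots> = ?c2 * (\<integral>\<^sup>+x. \<integral>\<^sup>+z. \<integral>\<^sup>+q. K2 z x q \<partial>lborel \<partial>lborel \<partial>lborel)"
    by (simp add: nn_integral_cmult)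
  also have "(\<integral>\<^sup>+x. \<integral>\<^sup>+z. \<integral>\<^sup>+q. K2 z x q \<partial>lborel \<partial>lborel \<partial>lborel)
      = (\<integral>\<^sup>+z. \<integral>\<^sup>+x. \<integral>\<^sup>+q. K2 z x q \<partial>lborel \<partial>lborel \<partial>lborel)"
    by (rule lborel_pair.Fubini') measurable
  also have "\<dots> \<le> (\<integral>\<^sup>+z. ?c3 * (\<integral>\<^sup>+x. \<integral>\<^sup>+q. K3 z x q \<partial>lborel \<partial>lborel) \<partial>lborel)"
    by (intro nn_integral_mono K23)
  also have "\<dots> = ?c3 * (\<integral>\<^sup>+z. \<integral>\<^sup>+x. \<integral>\<^sup>+q. K3 z x q \<partial>lborel \<partial>lborel \<partial>lborel)"
    by (rule nn_integral_cmult) measurable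
  also have "(\<integral>\<^sup>+z. \<integral>\<^sup>+x. \<integral>\<^sup>+q. K3 z x q \<partial>lborel \<partial>lborel \<partial>lborel)
      = (\<integral>\<^sup>+x. \<integral>\<^sup>+z. \<integral>\<^sup>+q. K3 z x q \<partial>lborel \<partial>lborel \<partial>lborel)"
    by (rule lborel_pair.Fubini') measurable
  also have "\<dots> = (\<integral>\<^sup>+x. \<integral>\<^sup>+q. \<integral>\<^sup>+z. K3 z x q \<partial>lborel \<partial>lborel \<partial>lborel)"
    by (intro nn_integral_cong lborel_pair.Fubini') measurable
  also have "\<dots> \<le> (\<integral>\<^sup>+x. \<integral>\<^sup>+q. ?c4 * (indicator \<Omega> x * (indicator \<Omega> q * k x q)) \<partial>lborel \<partial>lborel)"
    by (intro nn_integral_mono K3)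
  also have "\<dots> = ?c4 * gagliardo \<Omega> s u"
    unfolding gagliardo_def k_def by (rule nn_integral_cmult_2) measurable
  finally have "(\<integral>\<^sup>+x. indicator \<Omega> x * oscillation \<delta> s u x \<partial>lborel)
      \<le> ?c1 * (?c2 * (?c3 * (?c4 * gagliardo \<Omega> s u)))"
    by (meson mult_left_mono zero_le)
  also have "\<dots> = ennreal (4 * 64 ^ DIM('a) * (1 - s)) * gagliardo \<Omega> s u"
  proof -
    \<comment> \<open>The unit ball volume v introduced by averaging cancels the one gained when z
      is integrated out, and 8 * 4 * 2 = 64.\<close>
    have "8 ^ DIM('a) / v * (2 * 4 ^ DIM('a) * (2 * (1 - s) * (v * 2 ^ DIM('a))))
        = 4 * (8 ^ DIM('a) * 4 ^ DIM('a) * 2 ^ DIM('a)) * (1 - s)"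
      using v by simp
    also have "(8 ^ DIM('a) * 4 ^ DIM('a) * 2 ^ DIM('a) :: real) = 64 ^ DIM('a)"
      by (simp flip: power_mult_distrib)
    finally have e: "ennreal (4 * 64 ^ DIM('a) * (1 - s))
        = ennreal (8 ^ DIM('a) / v * (2 * 4 ^ DIM('a) * (2 * (1 - s) * (v * 2 ^ DIM('a)))))"
      by simp
    have "?c3 * ?c4 = ennreal (2 * (1 - s) * (v * 2 ^ DIM('a)))"
      using s v by (intro ennreal_mult[symmetric]) auto
    moreover have "?c1 * (?c2 * ennreal (2 * (1 - s) * (v * 2 ^ DIM('a))))
        = ennreal (4 * 64 ^ DIM('a) * (1 - s))"
      unfolding e using s v by (intro ennreal_mult_3) auto
    ultimately have "?c1 * (?c2 * (?c3 * ?c4)) = ennreal (4 * 64 ^ DIM('a) * (1 - s))" by simp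
    then show ?thesis by (simp only: mult.assoc[symmetric])
  qed
  finally show ?thesis .
qed

section \<open>Hardy inequality in a boundary chart\<close>

lemma ennreal_abs_triangle:
  fixes a b c k :: real
  assumes "0 \<le> k"
  shows "ennreal (k * \<bar>a - b\<bar>) \<le> ennreal (k * \<bar>b - c\<bar>) + ennreal (k * \<bar>a - c\<bar>)"
proof -
  have "k * \<bar>a - b\<bar> \<le> k * (\<bar>b - c\<bar> + \<bar>a - c\<bar>)"
    using assms by (intro mult_left_mono) linarith+
  then have "k * \<bar>a - b\<bar> \<le> k * \<bar>b - c\<bar> + k * \<bar>a - c\<bar>"
    by (simp add: distrib_left)
  then have "ennreal (k * \<bar>a - b\<bar>) \<le> ennreal (k * \<bar>b - c\<bar> + k * \<bar>a - c\<bar>)"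
    by (rule ennreal_leI)
  also have "\<dots> = ennreal (k * \<bar>b - c\<bar>) + ennreal (k * \<bar>a - c\<bar>)"
    using assms by (intro ennreal_plus) auto
  finally show ?thesis .
qed

text \<open>The triangle inequality through q, averaged over the ball of radius \<delta>(x)/16
  around x. This ball lies in the one of radius \<delta>(y)/8 around y: \<delta>(x)/16 +
  \<delta>(x)/32 = 3 \<delta>(x)/32, while \<delta>(y) \<ge> 31 \<delta>(x)/32.\<close>

lemma oscillation_two_points:
  fixes \<delta> u :: "'a::euclidean_space \<Rightarrow> real" and s :: real
  assumes [measurable]: "\<delta> \<in> borel_measurable borel" "u \<in> borel_measurable borel"
    and lip: "\<And>x y. \<delta> x \<le> \<delta> y + dist x y"
    and pos: "0 < \<delta> x" and near: "dist x y \<le> \<delta> x / 32" and s: "0 \<le> s" "s < 1"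
  shows "ennreal (\<delta> x powr -s * \<bar>u y - u x\<bar>)
    \<le> ennreal (2 * 32 ^ DIM('a) / unit_ball_vol (real DIM('a)))
      * (oscillation \<delta> s u x + oscillation \<delta> s u y)"
proof -
  let ?d = "real DIM('a)"
  define v where "v = unit_ball_vol ?d"
  have v: "0 < v" by (simp add: v_def)
  let ?k = "\<delta> x powr -(?d + s)"
  define b where "b q = (if dist x q < \<delta> x / 16 then 1 else 0 :: ennreal)" for q
  have [measurable]: "b \<in> borel_measurable borel" unfolding b_def[abs_def] by measurable
  have y: "\<delta> x \<le> \<delta> y + dist x y" "\<delta> y \<le> \<delta> x + dist x y"
    using lip[of x y] lip[of y x] by (auto simp: dist_commute)
  have k: "?k \<le> 2 * 2 ^ DIM('a) * \<delta> y powr -(?d + s)"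
  proof -
    have "?k \<le> 2 powr (?d + s) * \<delta> y powr -(?d + s)"
      using y near pos s by (intro powr_minus_comparable) auto
    also have "\<dots> \<le> (2 * 2 ^ DIM('a)) * \<delta> y powr -(?d + s)"
    proof (intro mult_right_mono)
      have "2 powr (?d + s) \<le> 2 powr (real (DIM('a) + 1))"
        using s by (intro powr_mono) auto
      also have "\<dots> = 2 ^ (DIM('a) + 1)" by (rule powr_realpow) simp
      finally show "2 powr (?d + s) \<le> 2 * 2 ^ DIM('a)" by simp
    qed simp
    finally show ?thesis .
  qed
  have vol: "(\<integral>\<^sup>+q. b q \<partial>lborel) = ennreal (v * (\<delta> x / 16) ^ DIM('a))"
  proof -
    have "(\<integral>\<^sup>+q. b q \<partial>lborel) = (\<integral>\<^sup>+q. indicator (ball x (\<delta> x / 16)) q \<partial>lborel)"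
      unfolding b_def by (intro nn_integral_cong) (auto split: split_indicator)
    then show ?thesis using pos emeasure_ball[of "\<delta> x / 16" x] by (simp add: v_def)
  qed
  have osc_x: "(\<integral>\<^sup>+q. b q * ennreal (?k * \<bar>u x - u q\<bar>) \<partial>lborel) \<le> oscillation \<delta> s u x"
    unfolding oscillation_def b_def using pos by (intro nn_integral_mono) auto
  have osc_y: "(\<integral>\<^sup>+q. b q * ennreal (?k * \<bar>u y - u q\<bar>) \<partial>lborel)
      \<le> ennreal (2 * 2 ^ DIM('a)) * oscillation \<delta> s u y"
  proof -
    have "b q * ennreal (?k * \<bar>u y - u q\<bar>) \<le> ennreal (2 * 2 ^ DIM('a)) *
        (if dist y q < \<delta> y / 8 then ennreal (\<delta> y powr -(?d + s) * \<bar>u y - u q\<bar>) else 0)" for q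
    proof (cases "dist x q < \<delta> x / 16")
      case True
      have "dist y q \<le> dist x y + dist x q" by metric
      then have "dist y q < \<delta> y / 8" using True near y pos by linarith
      moreover have "ennreal (?k * \<bar>u y - u q\<bar>)
          \<le> ennreal (2 * 2 ^ DIM('a)) * ennreal (\<delta> y powr -(?d + s) * \<bar>u y - u q\<bar>)"
      proof -
        have "?k * \<bar>u y - u q\<bar> \<le> 2 * 2 ^ DIM('a) * \<delta> y powr -(?d + s) * \<bar>u y - u q\<bar>"
          by (intro mult_right_mono k) simp
        then show ?thesis
          by (subst ennreal_mult[symmetric]) (auto intro!: ennreal_leI simp: mult.assoc)
      qed
      ultimately show ?thesis using True by (simp add: b_def)
    qed (simp add: b_def)
    then show ?thesis
      unfolding oscillation_def
      by (subst nn_integral_cmult[symmetric]) (auto intro: nn_integral_mono)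
  qed
  have "ennreal (?k * \<bar>u y - u x\<bar>) * ennreal (v * (\<delta> x / 16) ^ DIM('a))
      = (\<integral>\<^sup>+q. b q * ennreal (?k * \<bar>u y - u x\<bar>) \<partial>lborel)"
    unfolding vol[symmetric] by (subst nn_integral_multc) (auto simp: mult.commute)
  also have "\<dots> \<le> (\<integral>\<^sup>+q. b q * ennreal (?k * \<bar>u x - u q\<bar>) + b q * ennreal (?k * \<bar>u y - u q\<bar>) \<partial>lborel)"
    unfolding distrib_left[symmetric]
    by (intro nn_integral_mono mult_left_mono ennreal_abs_triangle) auto
  also have "\<dots> = (\<integral>\<^sup>+q. b q * ennreal (?k * \<bar>u x - u q\<bar>) \<partial>lborel)
      + (\<integral>\<^sup>+q. b q * ennreal (?k * \<bar>u y - u q\<bar>) \<partial>lborel)"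
    by (rule nn_integral_add) measurable
  also have "\<dots> \<le> oscillation \<delta> s u x + ennreal (2 * 2 ^ DIM('a)) * oscillation \<delta> s u y"
    by (intro add_mono osc_x osc_y)
  also have "\<dots> \<le> ennreal (2 * 2 ^ DIM('a)) * (oscillation \<delta> s u x + oscillation \<delta> s u y)"
  proof -
    have "(1::real) \<le> 2 * 2 ^ DIM('a)" using one_le_power[of "2::real" "DIM('a)"] by linarith
    then have "ennreal 1 * oscillation \<delta> s u x \<le> ennreal (2 * 2 ^ DIM('a)) * oscillation \<delta> s u x"
      by (intro mult_right_mono ennreal_leI) auto
    then show ?thesis unfolding distrib_left by (intro add_mono) auto
  qed
  finally have "ennreal (16 ^ DIM('a) / v) *
      (ennreal (?k * \<bar>u y - u x\<bar>) * ennreal (v * (\<delta> x / 16) ^ DIM('a)))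
     \<le> ennreal (16 ^ DIM('a) / v) *
       (ennreal (2 * 2 ^ DIM('a)) * (oscillation \<delta> s u x + oscillation \<delta> s u y))"
    by (rule mult_left_mono) simp
  moreover have "ennreal (16 ^ DIM('a) / v) *
      (ennreal (?k * \<bar>u y - u x\<bar>) * ennreal (v * (\<delta> x / 16) ^ DIM('a)))
      = ennreal (\<delta> x powr -s * \<bar>u y - u x\<bar>)"
  proof -
    have "?k * \<delta> x ^ DIM('a) = \<delta> x powr -s"
      using pos by (simp add: powr_realpow[symmetric] powr_add[symmetric])
    then have "16 ^ DIM('a) / v * (?k * \<bar>u y - u x\<bar> * (v * (\<delta> x / 16) ^ DIM('a)))
        = \<delta> x powr -s * \<bar>u y - u x\<bar>"
      using v by (simp add: power_divide)
    then show ?thesis using v pos by (subst ennreal_mult_3) auto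
  qed
  moreover have "ennreal (16 ^ DIM('a) / v) * (ennreal (2 * 2 ^ DIM('a)) * X)
      = ennreal (2 * 32 ^ DIM('a) / v) * X" for X
  proof -
    have "(16 ^ DIM('a) * 2 ^ DIM('a) :: real) = 32 ^ DIM('a)"
      by (simp flip: power_mult_distrib)
    then have "2 * 32 ^ DIM('a) / v = 16 ^ DIM('a) / v * (2 * 2 ^ DIM('a))" by simp
    moreover have "ennreal (16 ^ DIM('a) / v * (2 * 2 ^ DIM('a)))
        = ennreal (16 ^ DIM('a) / v) * ennreal (2 * 2 ^ DIM('a))"
      using v by (intro ennreal_mult) auto
    ultimately show ?thesis by (simp only: mult.assoc)
  qed
  ultimately show ?thesis by (simp only: v_def)
qed

text \<open>\<open>\<delta>\<close> plays the distance to the boundary and \<open>\<eta>\<close> the height above the graph; \<open>Z\<close> is a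
  cylinder parallel to \<open>\<nu>\<close>.\<close>

locale boundary_chart =
  fixes \<Omega> Z :: "'a::euclidean_space set" and \<delta> \<eta> :: "'a \<Rightarrow> real" and \<nu> :: 'a and K a :: real
  assumes Om[measurable]: "\<Omega> \<in> sets borel" and Z[measurable]: "Z \<in> sets borel"
    and delta[measurable]: "\<delta> \<in> borel_measurable borel"
    and eta[measurable]: "\<eta> \<in> borel_measurable borel"
    and nu: "norm \<nu> = 1" and K: "1 \<le> K" and a: "0 < a" "a \<le> 1"
    and delta_pos: "\<And>x. x \<in> \<Omega> \<Longrightarrow> 0 < \<delta> x"
    and delta_lip: "\<And>x y. \<delta> x \<le> \<delta> y + dist x y"
    and delta_ball: "\<And>x. x \<in> \<Omega> \<Longrightarrow> ball x (\<delta> x) \<subseteq> \<Omega>"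
    and shift: "\<And>x t. \<eta> (x + t *\<^sub>R \<nu>) = \<eta> x + t"
    and cyl: "\<And>x t. x + t *\<^sub>R \<nu> \<in> Z \<longleftrightarrow> x \<in> Z"
    and in_Om: "\<And>x. x \<in> Z \<Longrightarrow> 0 < \<eta> x \<Longrightarrow> \<eta> x < 2 * a \<Longrightarrow> x \<in> \<Omega>"
    and delta_le: "\<And>x. x \<in> Z \<Longrightarrow> 0 < \<eta> x \<Longrightarrow> \<eta> x < 2 * a \<Longrightarrow> \<delta> x \<le> \<eta> x"
    and delta_ge: "\<And>x. x \<in> Z \<Longrightarrow> 0 < \<eta> x \<Longrightarrow> \<eta> x < 2 * a \<Longrightarrow> \<eta> x \<le> K * \<delta> x"
begin

text \<open>Chosen with l K = 1/32: a point of height \<eta> \<le> K \<delta> moves by l \<eta>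
  \<le> \<delta>/32, the distance allowed in \<open>oscillation_two_points\<close>.\<close>

definition l :: real where "l = 1 / (32 * K)"

text \<open>The stretching T, with \<mu> = 1 + l. Since \<mu> \<le> 2, points of height below a stay
  below height 2 a, the range in which the locale compares \<eta> with \<delta>.\<close>

definition dil :: "'a \<Rightarrow> 'a" where "dil x = x + (l * \<eta> x) *\<^sub>R \<nu>"

lemma l_bounds: "0 < l" "l \<le> 1" "l * K = 1/32"
  using K by (auto simp: l_def)

lemma borel_measurable_dil [measurable]: "dil \<in> borel_measurable borel"
  unfolding dil_def[abs_def] by measurable

lemma eta_dil: "\<eta> (dil x) = (1 + l) * \<eta> x"
  by (simp add: dil_def shift algebra_simps)

lemma dil_in_Z: "dil x \<in> Z \<longleftrightarrow> x \<in> Z"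
  by (simp add: dil_def cyl)

lemma nn_integral_dil:
  "F \<in> borel_measurable borel \<Longrightarrow>
    (\<integral>\<^sup>+x. F x \<partial>lborel) = ennreal (1 + l) * (\<integral>\<^sup>+x. F (dil x) \<partial>lborel)"
  unfolding dil_def by (rule nn_integral_line_dilation) (use shift l_bounds in auto)

lemma nn_integral_dil_le:
  assumes "F \<in> borel_measurable borel"
  shows "(\<integral>\<^sup>+x. F (dil x) \<partial>lborel) \<le> (\<integral>\<^sup>+x. F x \<partial>lborel)"
proof -
  have "1 * (\<integral>\<^sup>+x. F (dil x) \<partial>lborel) \<le> ennreal (1 + l) * (\<integral>\<^sup>+x. F (dil x) \<partial>lborel)"
    using l_bounds by (intro mult_right_mono) (auto simp: ennreal_1[symmetric] simp del: ennreal_1 intro!: ennreal_leI)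
  then show ?thesis using nn_integral_dil[OF assms] by simp
qed

text \<open>The constant of \<open>oscillation_two_points\<close>: 16^d over the unit ball volume
  normalises the averaging ball, and 2 * 2^d compares powers of \<delta> at the two points.\<close>

definition osc_const :: real where
  "osc_const = 2 * 32 ^ DIM('a) / unit_ball_vol (real DIM('a))"

lemma osc_const_pos: "0 < osc_const"
  by (simp add: osc_const_def)

text \<open>Pointwise the integrand is bounded by the oscillations at x and at \<open>dil x\<close>.
  As the Jacobian of \<open>dil\<close> is at least 1, the integral of the second is at most that of
  the first, whence 8 = 2 * 4 in the constant.\<close>

lemma dil_difference_le:
  assumes [measurable]: "u \<in> borel_measurable borel" and s: "0 \<le> s" "s < 1"
  shows "(\<integral>\<^sup>+x. indicator {x\<in>Z. 0 < \<eta> x \<and> \<eta> x < a} x *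
      ennreal (\<eta> x powr -s * \<bar>u (dil x) - u x\<bar>) \<partial>lborel)
    \<le> ennreal (osc_const * (8 * 64 ^ DIM('a)) * (1 - s)) * gagliardo \<Omega> s u"
proof -
  define F where "F x = indicator \<Omega> x * oscillation \<delta> s u x" for x
  have [measurable]: "F \<in> borel_measurable borel" unfolding F_def[abs_def] by measurable
  have "indicator {x\<in>Z. 0 < \<eta> x \<and> \<eta> x < a} x * ennreal (\<eta> x powr -s * \<bar>u (dil x) - u x\<bar>)
      \<le> ennreal osc_const * (F x + F (dil x))" for x
  proof (cases "x \<in> Z \<and> 0 < \<eta> x \<and> \<eta> x < a")
    case True
    then have x: "x \<in> Z" "0 < \<eta> x" "\<eta> x < 2 * a" using a by auto
    have xO: "x \<in> \<Omega>" using in_Om[OF x] .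
    have "(1 + l) * \<eta> x \<le> 2 * \<eta> x" using l_bounds x by (intro mult_right_mono) auto
    then have "(1 + l) * \<eta> x < 2 * a" using True by linarith
    then have yO: "dil x \<in> \<Omega>"
      using x l_bounds by (intro in_Om) (auto simp: dil_in_Z eta_dil)
    have "dist x (dil x) = l * \<eta> x"
      using nu x l_bounds by (simp add: dil_def dist_norm)
    also have "\<dots> \<le> l * (K * \<delta> x)"
      using delta_ge[OF x] l_bounds by (intro mult_left_mono) auto
    finally have d: "dist x (dil x) \<le> \<delta> x / 32"
      using l_bounds(3) by (simp flip: mult.assoc)
    have "\<eta> x powr -s \<le> \<delta> x powr -s"
      using delta_le[OF x] delta_pos[OF xO] s by (intro powr_mono2') auto
    then have "ennreal (\<eta> x powr -s * \<bar>u (dil x) - u x\<bar>) \<le> ennreal (\<delta> x powr -s * \<bar>u (dil x) - u x\<bar>)"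
      by (intro ennreal_leI mult_right_mono) auto
    also have "\<dots> \<le> ennreal osc_const * (oscillation \<delta> s u x + oscillation \<delta> s u (dil x))"
      unfolding osc_const_def using delta_lip delta_pos[OF xO] d s
      by (intro oscillation_two_points) auto
    finally show ?thesis using True xO yO by (simp add: F_def)
  qed simp
  then have "(\<integral>\<^sup>+x. indicator {x\<in>Z. 0 < \<eta> x \<and> \<eta> x < a} x *
      ennreal (\<eta> x powr -s * \<bar>u (dil x) - u x\<bar>) \<partial>lborel)
      \<le> (\<integral>\<^sup>+x. ennreal osc_const * (F x + F (dil x)) \<partial>lborel)"
    by (rule nn_integral_mono)
  also have "\<dots> = ennreal osc_const * ((\<integral>\<^sup>+x. F x \<partial>lborel) + (\<integral>\<^sup>+x. F (dil x) \<partial>lborel))"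
    by (simp add: nn_integral_cmult nn_integral_add)
  also have "\<dots> \<le> ennreal osc_const * ((\<integral>\<^sup>+x. F x \<partial>lborel) + (\<integral>\<^sup>+x. F x \<partial>lborel))"
    by (intro mult_left_mono add_left_mono nn_integral_dil_le) auto
  also have "\<dots> \<le> ennreal osc_const * (2 * (ennreal (4 * 64 ^ DIM('a) * (1 - s)) * gagliardo \<Omega> s u))"
    unfolding mult_2[symmetric] F_def
    using delta_pos delta_lip delta_ball s
    by (intro mult_left_mono nn_integral_oscillation_le) auto
  also have "\<dots> = ennreal (osc_const * (8 * 64 ^ DIM('a)) * (1 - s)) * gagliardo \<Omega> s u"
  proof -
    have "ennreal osc_const * (ennreal 2 * ennreal (4 * 64 ^ DIM('a) * (1 - s)))
        = ennreal (osc_const * (2 * (4 * 64 ^ DIM('a) * (1 - s))))"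
      using s osc_const_pos by (intro ennreal_mult_3) auto
    also have "osc_const * (2 * (4 * 64 ^ DIM('a) * (1 - s))) = osc_const * (8 * 64 ^ DIM('a)) * (1 - s)"
      by simp
    finally show ?thesis by (simp only: mult.assoc[symmetric] ennreal_numeral)
  qed
  finally show ?thesis .
qed

text \<open>The heart of the Hardy inequality, for an abstract test function \<Lambda>; the
  application takes a dilated iterated logarithm. The right-hand side contains neither \<Lambda> nor
  e, so it is uniform in m and the truncation can be removed afterwards.\<close>

lemma truncated_chart_hardy:
  fixes \<Lambda> :: "real \<Rightarrow> real"
  assumes [measurable]: "u \<in> borel_measurable borel" "\<Lambda> \<in> borel_measurable borel"
    and s: "0 \<le> s" "s < 1" and e: "0 < e" "e < a"
    and range: "\<And>t. 0 < t \<Longrightarrow> t < a \<Longrightarrow> 0 \<le> \<Lambda> t \<and> \<Lambda> t \<le> 1"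
    and mono: "\<And>t. 0 < t \<Longrightarrow> t < a \<Longrightarrow> \<Lambda> (t / (1 + l)) \<le> \<Lambda> t"
    and fin: "(\<integral>\<^sup>+x. indicator \<Omega> x * ennreal \<bar>u x\<bar> \<partial>lborel) < \<infinity>"
  shows "(\<integral>\<^sup>+x. indicator {x\<in>Z. e < \<eta> x \<and> \<eta> x < a} x *
      ennreal (\<eta> x powr -s * (\<Lambda> (\<eta> x) - \<Lambda> (\<eta> x / (1 + l))) * \<bar>u x\<bar>) \<partial>lborel)
    \<le> ennreal (1 / a) * (\<integral>\<^sup>+x. indicator \<Omega> x * ennreal \<bar>u x\<bar> \<partial>lborel)
      + ennreal (osc_const * (8 * 64 ^ DIM('a)) * (1 - s)) * gagliardo \<Omega> s u"
proof -
  define \<mu> where "\<mu> = 1 + l"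
  have mu: "1 < \<mu>" "\<mu> \<le> 2" using l_bounds by (auto simp: \<mu>_def)
  define V where "V = {x\<in>Z. e < \<eta> x \<and> \<eta> x < a}"
  have [measurable]: "V \<in> sets borel" unfolding V_def by measurable
  let ?N = "\<integral>\<^sup>+x. indicator \<Omega> x * ennreal \<bar>u x\<bar> \<partial>lborel"
  \<comment> \<open>\<open>A + B\<close> is the full weight \<eta>^(-s) \<Lambda>(\<eta>) |u|, split
    into the part at the lower argument and the increment. \<open>F\<close> is arranged so that
    \<open>F (dil x)\<close> carries the weight at x but the value of u at \<open>dil x\<close>;
    \<open>E\<close> is the error of that exchange.\<close>
  define A where "A x = indicator V x * ennreal (\<eta> x powr -s * \<Lambda> (\<eta> x / \<mu>) * \<bar>u x\<bar>)" for x
  define B where "B x = indicator V x * ennreal (\<eta> x powr -s * (\<Lambda> (\<eta> x) - \<Lambda> (\<eta> x / \<mu>)) * \<bar>u x\<bar>)" for x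
  define E where "E x = indicator {x\<in>Z. 0 < \<eta> x \<and> \<eta> x < a} x *
      ennreal (\<eta> x powr -s * \<bar>u (dil x) - u x\<bar>)" for x
  define F where "F x = (if x \<in> Z \<and> e < \<eta> x / \<mu> \<and> \<eta> x / \<mu> < a
      then ennreal ((\<eta> x / \<mu>) powr -s * \<Lambda> (\<eta> x / \<mu>) * \<bar>u x\<bar>) else 0)" for x
  have [measurable]: "A \<in> borel_measurable borel" "B \<in> borel_measurable borel"
      "E \<in> borel_measurable borel" "F \<in> borel_measurable borel"
    unfolding A_def[abs_def] B_def[abs_def] E_def[abs_def] F_def[abs_def] by measurable
  have V: "x \<in> \<Omega>" "0 < \<eta> x" "\<eta> x < a" "e < \<eta> x" "x \<in> Z" if "x \<in> V" for x
    using that in_Om[of x] e a by (auto simp: V_def)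
  have below: "0 \<le> \<Lambda> (t / \<mu>)" "\<Lambda> (t / \<mu>) \<le> 1" if "0 < t" "t < \<mu> * a" for t
    using range[of "t / \<mu>"] that mu by (auto simp: pos_divide_less_eq mult.commute)
  have lt: "t < \<mu> * a" if "t < a" for t
    using that mult_right_mono[of 1 \<mu> a] mu a by linarith
  have powr_le: "t powr -s \<le> 1 / c" if "0 < c" "c \<le> 1" "c \<le> t" for c t
  proof -
    have "t powr -s \<le> c powr -s" using that s by (intro powr_mono2') auto
    also have "\<dots> \<le> c powr -1" using that s by (intro powr_mono') auto
    finally show ?thesis using that by (simp add: powr_minus_divide)
  qed
  \<comment> \<open>The truncation acts here: above height e the weight is at most 1 / e. Finiteness
    permits the cancellation of \<open>A\<close> at the end.\<close>
  have A_fin: "(\<integral>\<^sup>+x. A x \<partial>lborel) < \<infinity>"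
  proof -
    have "A x \<le> ennreal (1 / e) * (indicator \<Omega> x * ennreal \<bar>u x\<bar>)" for x
    proof (cases "x \<in> V")
      case True
      note x = V[OF True]
      have "\<eta> x powr -s * \<Lambda> (\<eta> x / \<mu>) \<le> 1 / e * 1"
        using x below[OF x(2) lt] powr_le[of e "\<eta> x"] e a by (intro mult_mono) auto
      then have "\<eta> x powr -s * \<Lambda> (\<eta> x / \<mu>) * \<bar>u x\<bar> \<le> 1 / e * \<bar>u x\<bar>"
        by (intro mult_right_mono) auto
      then have "ennreal (\<eta> x powr -s * \<Lambda> (\<eta> x / \<mu>) * \<bar>u x\<bar>) \<le> ennreal (1 / e * \<bar>u x\<bar>)"
        by (rule ennreal_leI)
      also have "\<dots> = ennreal (1 / e) * ennreal \<bar>u x\<bar>"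
        using e by (intro ennreal_mult) auto
      finally show ?thesis using True x by (simp add: A_def)
    qed (simp add: A_def)
    then have "(\<integral>\<^sup>+x. A x \<partial>lborel) \<le> ennreal (1 / e) * ?N"
      by (subst nn_integral_cmult[symmetric]) (auto intro: nn_integral_mono)
    also have "\<dots> < \<infinity>" using fin by (simp add: ennreal_mult_less_top)
    finally show ?thesis .
  qed
  have upper: "A x + B x \<le> F (dil x) + E x" for x
  proof (cases "x \<in> V")
    case True
    note x = V[OF True]
    have r: "0 \<le> \<Lambda> (\<eta> x)" "\<Lambda> (\<eta> x) \<le> 1" using range[of "\<eta> x"] x by auto
    have "A x + B x = ennreal (\<eta> x powr -s * \<Lambda> (\<eta> x / \<mu>) * \<bar>u x\<bar>
        + \<eta> x powr -s * (\<Lambda> (\<eta> x) - \<Lambda> (\<eta> x / \<mu>)) * \<bar>u x\<bar>)"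
      using True mono[of "\<eta> x"] below[OF x(2) lt] x unfolding A_def B_def
      by (subst ennreal_plus) (auto simp: \<mu>_def)
    also have "\<eta> x powr -s * \<Lambda> (\<eta> x / \<mu>) * \<bar>u x\<bar>
        + \<eta> x powr -s * (\<Lambda> (\<eta> x) - \<Lambda> (\<eta> x / \<mu>)) * \<bar>u x\<bar>
        = \<eta> x powr -s * \<Lambda> (\<eta> x) * \<bar>u x\<bar>"
      by (simp add: algebra_simps)
    also have "\<dots> \<le> ennreal (\<eta> x powr -s * \<Lambda> (\<eta> x) * \<bar>u (dil x)\<bar> + \<eta> x powr -s * \<bar>u (dil x) - u x\<bar>)"
    proof (rule ennreal_leI)
      have "\<eta> x powr -s * \<Lambda> (\<eta> x) * \<bar>u x\<bar>
          \<le> \<eta> x powr -s * \<Lambda> (\<eta> x) * (\<bar>u (dil x)\<bar> + \<bar>u (dil x) - u x\<bar>)"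
        using r by (intro mult_left_mono) auto
      moreover have "\<eta> x powr -s * \<Lambda> (\<eta> x) * \<bar>u (dil x) - u x\<bar> \<le> \<eta> x powr -s * 1 * \<bar>u (dil x) - u x\<bar>"
        using r by (intro mult_mono) auto
      ultimately show "\<eta> x powr -s * \<Lambda> (\<eta> x) * \<bar>u x\<bar>
          \<le> \<eta> x powr -s * \<Lambda> (\<eta> x) * \<bar>u (dil x)\<bar> + \<eta> x powr -s * \<bar>u (dil x) - u x\<bar>"
        by (simp add: distrib_left)
    qed
    also have "\<dots> = ennreal (\<eta> x powr -s * \<Lambda> (\<eta> x) * \<bar>u (dil x)\<bar>) + ennreal (\<eta> x powr -s * \<bar>u (dil x) - u x\<bar>)"
      using r by (intro ennreal_plus) auto
    also have "\<dots> = F (dil x) + E x"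
      using x mu by (simp add: F_def E_def dil_in_Z eta_dil flip: \<mu>_def)
    finally show ?thesis .
  qed (simp add: A_def B_def)
  \<comment> \<open>Below height a the point lies in \<open>V\<close>, because \<eta> > \<mu> e
    \<ge> e, and \<open>A\<close> dominates; the shell a \<le> \<eta> < \<mu> a is left to the L1
    norm. In both regions (\<eta>/\<mu>)^(-s) \<le> \<mu> \<eta>^(-s).\<close>
  have F_le: "F x \<le> ennreal \<mu> * (A x + ennreal (1 / a) * (indicator \<Omega> x * ennreal \<bar>u x\<bar>))" for x
  proof (cases "x \<in> Z \<and> e < \<eta> x / \<mu> \<and> \<eta> x / \<mu> < a")
    case True
    have x: "0 < \<eta> x" "\<mu> * e < \<eta> x" "\<eta> x < \<mu> * a"
    proof -
      show *: "\<mu> * e < \<eta> x" "\<eta> x < \<mu> * a"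
        using True mu by (auto simp: pos_divide_less_eq pos_less_divide_eq mult.commute)
      have "0 < \<mu> * e" using mu e by simp
      then show "0 < \<eta> x" using * by linarith
    qed
    have "\<mu> * a \<le> 2 * a" using mu a by simp
    then have xO: "x \<in> \<Omega>" using True x by (intro in_Om) auto
    note b = below[OF x(1,3)]
    have "(\<eta> x / \<mu>) powr -s = \<mu> powr s * \<eta> x powr -s"
      using x mu by (simp add: powr_divide powr_minus divide_simps)
    also have "\<dots> \<le> \<mu> powr 1 * \<eta> x powr -s"
      using mu s by (intro mult_right_mono powr_mono) auto
    finally have p: "(\<eta> x / \<mu>) powr -s \<le> \<mu> * \<eta> x powr -s" using mu by simp
    have "F x \<le> ennreal (\<mu> * (\<eta> x powr -s * \<Lambda> (\<eta> x / \<mu>) * \<bar>u x\<bar>))"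
    proof -
      have "(\<eta> x / \<mu>) powr -s * (\<Lambda> (\<eta> x / \<mu>) * \<bar>u x\<bar>) \<le> \<mu> * \<eta> x powr -s * (\<Lambda> (\<eta> x / \<mu>) * \<bar>u x\<bar>)"
        using b by (intro mult_right_mono p) auto
      then show ?thesis using True by (auto simp: F_def mult.assoc intro!: ennreal_leI)
    qed
    also have "\<dots> = ennreal \<mu> * ennreal (\<eta> x powr -s * \<Lambda> (\<eta> x / \<mu>) * \<bar>u x\<bar>)"
      using mu b by (intro ennreal_mult) auto
    also have "ennreal (\<eta> x powr -s * \<Lambda> (\<eta> x / \<mu>) * \<bar>u x\<bar>)
        \<le> A x + ennreal (1 / a) * (indicator \<Omega> x * ennreal \<bar>u x\<bar>)"
    proof (cases "\<eta> x < a")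
      case lt_a: True
      have "e * 1 \<le> e * \<mu>" using mu e by (intro mult_left_mono) auto
      then have "x \<in> V" using True lt_a x by (simp add: V_def mult.commute)
      then show ?thesis by (simp add: A_def)
    next
      case False
      have "\<eta> x powr -s * \<Lambda> (\<eta> x / \<mu>) \<le> 1 / a * 1"
        using b powr_le[of a "\<eta> x"] a False by (intro mult_mono) auto
      then have "\<eta> x powr -s * \<Lambda> (\<eta> x / \<mu>) * \<bar>u x\<bar> \<le> 1 / a * \<bar>u x\<bar>"
        by (intro mult_right_mono) auto
      then have "ennreal (\<eta> x powr -s * \<Lambda> (\<eta> x / \<mu>) * \<bar>u x\<bar>) \<le> ennreal (1 / a * \<bar>u x\<bar>)"
        by (rule ennreal_leI)
      also have "\<dots> = ennreal (1 / a) * ennreal \<bar>u x\<bar>"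
        using a by (intro ennreal_mult) auto
      finally show ?thesis using xO by (auto intro: add_increasing)
    qed
    finally show ?thesis by (meson mult_left_mono zero_le)
  next
    case False
    then have "F x = 0" by (simp only: F_def if_False)
    then show ?thesis by simp
  qed
  \<comment> \<open>The Jacobian on the left equals the constant of \<open>F_le\<close>, so
    \<open>A\<close> returns with coefficient exactly 1.\<close>
  have "ennreal \<mu> * (\<integral>\<^sup>+x. F (dil x) \<partial>lborel) = (\<integral>\<^sup>+x. F x \<partial>lborel)"
    unfolding \<mu>_def by (rule nn_integral_dil[symmetric]) measurable
  also have "\<dots> \<le> (\<integral>\<^sup>+x. ennreal \<mu> * (A x + ennreal (1 / a) * (indicator \<Omega> x * ennreal \<bar>u x\<bar>)) \<partial>lborel)"
    by (intro nn_integral_mono F_le)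
  also have "\<dots> = ennreal \<mu> * ((\<integral>\<^sup>+x. A x \<partial>lborel) + ennreal (1 / a) * ?N)"
    by (simp add: nn_integral_cmult nn_integral_add)
  finally have F_dil: "(\<integral>\<^sup>+x. F (dil x) \<partial>lborel) \<le> (\<integral>\<^sup>+x. A x \<partial>lborel) + ennreal (1 / a) * ?N"
    using mu by (subst (asm) ennreal_mult_le_mult_iff) auto
  have "(\<integral>\<^sup>+x. A x \<partial>lborel) + (\<integral>\<^sup>+x. B x \<partial>lborel) = (\<integral>\<^sup>+x. A x + B x \<partial>lborel)"
    by (simp add: nn_integral_add)
  also have "\<dots> \<le> (\<integral>\<^sup>+x. F (dil x) + E x \<partial>lborel)"
    by (intro nn_integral_mono upper)
  also have "\<dots> = (\<integral>\<^sup>+x. F (dil x) \<partial>lborel) + (\<integral>\<^sup>+x. E x \<partial>lborel)"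
    by (simp add: nn_integral_add)
  also have "\<dots> \<le> ((\<integral>\<^sup>+x. A x \<partial>lborel) + ennreal (1 / a) * ?N)
      + ennreal (osc_const * (8 * 64 ^ DIM('a)) * (1 - s)) * gagliardo \<Omega> s u"
    unfolding E_def using s by (intro add_mono F_dil dil_difference_le) auto
  finally have "(\<integral>\<^sup>+x. B x \<partial>lborel)
      \<le> ennreal (1 / a) * ?N + ennreal (osc_const * (8 * 64 ^ DIM('a)) * (1 - s)) * gagliardo \<Omega> s u"
    using A_fin by (auto simp: add.assoc)
  then show ?thesis by (simp add: B_def V_def \<mu>_def)
qed

text \<open>For the chosen \<Lambda> the increment runs from \<eta>/r to (1 + l) \<eta>/r and
  dominates the weight; 2 a \<le> r keeps these arguments below 1. In \<open>64 * K\<^sup>2\<close>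
  one K comes from \<delta>^(-s) \<le> K \<eta>^(-s), and the rest is 2 / l = 64 K.\<close>

lemma chart_hardy:
  assumes [measurable]: "u \<in> borel_measurable borel"
    and s: "0 \<le> s" "s < 1" and r: "2 * a \<le> r"
    and fin: "(\<integral>\<^sup>+x. indicator \<Omega> x * ennreal \<bar>u x\<bar> \<partial>lborel) < \<infinity>"
  shows "(\<integral>\<^sup>+x. indicator {x\<in>Z. 0 < \<eta> x \<and> \<eta> x < a} x *
      ennreal (\<bar>u x\<bar> / \<delta> x powr s * log_weight (Suc m) (\<delta> x / r)) \<partial>lborel)
    \<le> ennreal (64 * K\<^sup>2) * (ennreal (1 / a) * (\<integral>\<^sup>+x. indicator \<Omega> x * ennreal \<bar>u x\<bar> \<partial>lborel)
      + ennreal (osc_const * (8 * 64 ^ DIM('a)) * (1 - s)) * gagliardo \<Omega> s u)"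
    (is "(\<integral>\<^sup>+x. ?h x \<partial>lborel) \<le> ?R")
proof -
  define \<Lambda> where "\<Lambda> t = log_L (Suc m) ((1 + l) * t / r)" for t
  have [measurable]: "\<Lambda> \<in> borel_measurable borel" unfolding \<Lambda>_def[abs_def] by measurable
  have r0: "0 < r" using r a by linarith
  have lt1: "(1 + l) * t / r < 1" if "0 < t" "t < a" for t
  proof -
    have "(1 + l) * t \<le> 2 * t" using l_bounds that by (intro mult_right_mono) auto
    then have "(1 + l) * t < r" using that r by linarith
    then show ?thesis using r0 by (simp add: pos_divide_less_eq)
  qed
  define g where "g x = \<eta> x powr -s * (\<Lambda> (\<eta> x) - \<Lambda> (\<eta> x / (1 + l))) * \<bar>u x\<bar>" for x
  have point: "\<bar>u x\<bar> / \<delta> x powr s * log_weight (Suc m) (\<delta> x / r) \<le> (64 * K\<^sup>2) * g x"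
    if x: "x \<in> Z" "0 < \<eta> x" "\<eta> x < a" for x
  proof -
    have x': "\<eta> x < 2 * a" using x a by simp
    note d = delta_pos[OF in_Om[OF x(1,2) x']] delta_le[OF x(1,2) x'] delta_ge[OF x(1,2) x']
    have t: "0 < \<eta> x / r" "\<eta> x / r < 1" using x r r0 a by (auto simp: field_simps)
    have w: "0 < log_weight (Suc m) (\<delta> x / r)" "log_weight (Suc m) (\<delta> x / r) \<le> log_weight (Suc m) (\<eta> x / r)"
      using d t r0 by (auto intro!: log_weight_mono log_weight_pos divide_right_mono
          intro: le_less_trans[OF divide_right_mono])
    have "1 / \<delta> x powr s \<le> K * \<eta> x powr -s"
    proof -
      have "\<delta> x powr -s \<le> (\<eta> x / K) powr -s"
        using d x K s by (intro powr_mono2') (auto simp: field_simps)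
      also have "\<dots> = K powr s * \<eta> x powr -s"
        using x K by (simp add: powr_divide powr_minus divide_simps)
      also have "\<dots> \<le> K powr 1 * \<eta> x powr -s"
        using K s by (intro mult_right_mono powr_mono) auto
      finally show ?thesis using K by (simp add: powr_minus_divide)
    qed
    then have "1 / \<delta> x powr s * log_weight (Suc m) (\<delta> x / r)
        \<le> K * \<eta> x powr -s * log_weight (Suc m) (\<eta> x / r)"
      using w K by (intro mult_mono) auto
    also have "\<dots> \<le> K * \<eta> x powr -s * (64 * K * (\<Lambda> (\<eta> x) - \<Lambda> (\<eta> x / (1 + l))))"
    proof (intro mult_left_mono)
      have "l / 2 \<le> l / (1 + l)" using l_bounds by (intro divide_left_mono) auto
      then have "l / 2 * log_weight (Suc m) (\<eta> x / r) \<le> l / (1 + l) * log_weight (Suc m) (\<eta> x / r)"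
        using log_weight_pos[OF t] by (intro mult_right_mono) (auto intro: less_imp_le)
      also have "\<dots> \<le> \<Lambda> (\<eta> x) - \<Lambda> (\<eta> x / (1 + l))"
        using log_L_dilation_increment[of "\<eta> x / r" "1 + l" m] t l_bounds lt1[OF x(2,3)]
        by (simp add: \<Lambda>_def)
      finally have "64 * K * (l / 2 * log_weight (Suc m) (\<eta> x / r)) \<le> 64 * K * (\<Lambda> (\<eta> x) - \<Lambda> (\<eta> x / (1 + l)))"
        using K by (intro mult_left_mono) auto
      moreover have "64 * K * (l / 2 * X) = X" for X using K by (simp add: l_def)
      ultimately show "log_weight (Suc m) (\<eta> x / r) \<le> 64 * K * (\<Lambda> (\<eta> x) - \<Lambda> (\<eta> x / (1 + l)))"
        by (simp only:)
    qed (use K in auto)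
    finally have "\<bar>u x\<bar> * (1 / \<delta> x powr s * log_weight (Suc m) (\<delta> x / r))
        \<le> \<bar>u x\<bar> * (K * \<eta> x powr -s * (64 * K * (\<Lambda> (\<eta> x) - \<Lambda> (\<eta> x / (1 + l)))))"
      by (intro mult_left_mono) auto
    then show ?thesis by (simp add: g_def power2_eq_square mult_ac)
  qed
  have trunc: "(\<integral>\<^sup>+x. indicator {x. e < \<eta> x} x * ?h x \<partial>lborel) \<le> ?R" if e: "0 < e" "e < a" for e
  proof -
    have "indicator {x. e < \<eta> x} x * ?h x
       \<le> ennreal (64 * K\<^sup>2) * (indicator {x\<in>Z. e < \<eta> x \<and> \<eta> x < a} x * ennreal (g x))" for x
    proof (cases "x \<in> Z \<and> e < \<eta> x \<and> \<eta> x < a")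
      case True
      then have "ennreal (\<bar>u x\<bar> / \<delta> x powr s * log_weight (Suc m) (\<delta> x / r)) \<le> ennreal (64 * K\<^sup>2 * g x)"
        using e by (intro ennreal_leI point) auto
      then show ?thesis using True e by (simp add: ennreal_mult')
    next
      case False
      then have "indicator {x. e < \<eta> x} x * ?h x = 0" by (auto split: split_indicator)
      then show ?thesis by (simp only: zero_le)
    qed
    then have "(\<integral>\<^sup>+x. indicator {x. e < \<eta> x} x * ?h x \<partial>lborel)
        \<le> (\<integral>\<^sup>+x. ennreal (64 * K\<^sup>2) * (indicator {x\<in>Z. e < \<eta> x \<and> \<eta> x < a} x * ennreal (g x)) \<partial>lborel)"
      by (rule nn_integral_mono)
    also have "\<dots> = ennreal (64 * K\<^sup>2) * (\<integral>\<^sup>+x. indicator {x\<in>Z. e < \<eta> x \<and> \<eta> x < a} x * ennreal (g x) \<partial>lborel)"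
      unfolding g_def by (rule nn_integral_cmult) measurable
    also have "\<dots> \<le> ?R"
      unfolding g_def
    proof (intro mult_left_mono truncated_chart_hardy fin e s)
      fix t :: real assume t: "0 < t" "t < a"
      have t1: "0 < (1 + l) * t / r" "0 < t / r" using t r0 l_bounds by auto
      show "0 \<le> \<Lambda> t \<and> \<Lambda> t \<le> 1"
        unfolding \<Lambda>_def using log_L_pos_less_1[OF t1(1) lt1[OF t]] by (auto intro: less_imp_le)
      have "t / r \<le> (1 + l) * t / r"
        using t r0 l_bounds by (intro divide_right_mono) auto
      then show "\<Lambda> (t / (1 + l)) \<le> \<Lambda> t"
        unfolding \<Lambda>_def using t1 lt1[OF t] l_bounds by (intro log_L_mono) auto
    qed auto
    finally show ?thesis .
  qed
  \<comment> \<open>The heights above a / (n + 2) exhaust the chart; the shift by 2 keeps the level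
    below a already for n = 0.\<close>
  define h where "h n x = indicator {x. a / (real n + 2) < \<eta> x} x * ?h x" for n :: nat and x
  have "?h x \<le> (SUP n. h n x)" for x
  proof (cases "0 < \<eta> x")
    case True
    obtain n :: nat where "a / \<eta> x < real n" using reals_Archimedean2 by blast
    then have "a / (real n + 2) < \<eta> x" using True a by (simp add: field_simps)
    then have "?h x = h n x" by (simp add: h_def)
    also have "\<dots> \<le> (SUP n. h n x)" by (rule SUP_upper) simp
    finally show ?thesis .
  qed simp
  then have "(\<integral>\<^sup>+x. ?h x \<partial>lborel) \<le> (\<integral>\<^sup>+x. (SUP n. h n x) \<partial>lborel)"
    by (rule nn_integral_mono)
  also have "\<dots> = (SUP n. \<integral>\<^sup>+x. h n x \<partial>lborel)"
  proof (rule nn_integral_monotone_convergence_SUP)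
    show "incseq h"
      unfolding h_def incseq_def le_fun_def
    proof (intro allI impI mult_right_mono)
      fix m n :: nat and x :: 'a assume "m \<le> n"
      then have "a / (real n + 2) \<le> a / (real m + 2)" using a by (intro divide_left_mono) auto
      then show "indicator {x. a / (real m + 2) < \<eta> x} x \<le> (indicator {x. a / (real n + 2) < \<eta> x} x :: ennreal)"
        by (auto split: split_indicator)
    qed simp
    show "h n \<in> borel_measurable lborel" for n unfolding h_def[abs_def] by measurable
  qed
  also have "\<dots> \<le> ?R"
  proof (rule SUP_least)
    fix n :: nat
    have "a / (real n + 2) < a / 1" using a by (intro divide_strict_left_mono) auto
    then show "(\<integral>\<^sup>+x. h n x \<partial>lborel) \<le> ?R" unfolding h_def using a by (intro trunc) auto
  qed
  finally show ?thesis .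
qed

end

section \<open>Lipschitz domains\<close>

lemma bounded_Lipschitz_domainD:
  fixes \<Omega> :: "(real^'n) set"
  assumes "bounded_Lipschitz_domain \<Omega>"
  shows "\<Omega> \<noteq> {}" "open \<Omega>" "bounded \<Omega>" "frontier \<Omega> \<noteq> {}"
proof -
  show *: "\<Omega> \<noteq> {}" "open \<Omega>" "bounded \<Omega>"
    using assms by (auto simp: bounded_Lipschitz_domain_def)
  have "\<Omega> \<noteq> UNIV" using *(3) not_bounded_UNIV by metis
  then show "frontier \<Omega> \<noteq> {}" using *(1) by (rule frontier_not_empty[rotated])
qed

lemma bdist_lipschitz: "bdist \<Omega> x \<le> bdist \<Omega> y + dist x y"
  unfolding bdist_def by (rule infdist_triangle)

lemma borel_measurable_bdist [measurable]: "bdist \<Omega> \<in> borel_measurable borel"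
  unfolding bdist_def[abs_def] by (intro borel_measurable_continuous_onI continuous_intros)

lemma bdist_pos:
  fixes \<Omega> :: "(real^'n) set"
  assumes "open \<Omega>" "frontier \<Omega> \<noteq> {}" "x \<in> \<Omega>"
  shows "0 < bdist \<Omega> x"
  unfolding bdist_def using assms
  by (intro infdist_pos_not_in_closed) (auto simp: frontier_def interior_open)

text \<open>A ball meeting both \<Omega> and its complement is connected, hence meets the frontier,
  yet no frontier point is closer than \<open>bdist \<Omega> x\<close>.\<close>

lemma ball_bdist_subset:
  fixes \<Omega> :: "(real^'n) set"
  assumes "x \<in> \<Omega>"
  shows "ball x (bdist \<Omega> x) \<subseteq> \<Omega>"
proof (rule ccontr)
  assume *: "\<not> ball x (bdist \<Omega> x) \<subseteq> \<Omega>"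
  then have "0 < bdist \<Omega> x" by (metis ball_empty empty_subsetI not_less)
  then have "ball x (bdist \<Omega> x) \<inter> frontier \<Omega> \<noteq> {}"
    using * assms centre_in_ball[of x "bdist \<Omega> x"] by (intro connected_Int_frontier) blast+
  then obtain z where "z \<in> frontier \<Omega>" "dist x z < bdist \<Omega> x" by auto
  then show False using infdist_le[of z "frontier \<Omega>" x] by (simp add: bdist_def)
qed

text \<open>The height \<eta> is Lipschitz with K = 1 + L and vanishes on the frontier near p, which
  gives \<eta> \<le> K \<delta>; descending from x by \<eta>(x) along \<nu> reaches the frontier,
  which gives \<delta> \<le> \<eta>. The bound A fits the chart to the scale of the logarithms, and
  the topological facts on Z and \<eta> serve the divergence proof.\<close>

lemma boundary_chart_exists:
  fixes \<Omega> :: "(real^'n) set"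
  assumes Om: "bounded_Lipschitz_domain \<Omega>" and p: "p \<in> frontier \<Omega>" and A: "0 < A"
  obtains Z \<eta> \<nu> K a \<rho> where "boundary_chart \<Omega> Z (bdist \<Omega>) \<eta> \<nu> K a" "a \<le> A"
    "0 < \<rho>" "\<Omega> \<inter> ball p \<rho> \<subseteq> {x\<in>Z. 0 < \<eta> x \<and> \<eta> x < a}"
    "p \<in> Z" "open Z" "continuous_on UNIV \<eta>" "\<eta> p = 0"
proof -
  note Om' = bounded_Lipschitz_domainD[OF Om]
  obtain r \<nu> \<phi> L where r: "0 < r" and nu: "norm \<nu> = 1"
    and phi: "L-lipschitz_on {y. y \<bullet> \<nu> = 0} \<phi>"
    and graph: "\<Omega> \<inter> ball p r = {x \<in> ball p r. \<phi> (x - (x \<bullet> \<nu>) *\<^sub>R \<nu>) < x \<bullet> \<nu>}"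
    using Om p unfolding bounded_Lipschitz_domain_def by blast
  define \<pi> where "\<pi> x = x - (x \<bullet> \<nu>) *\<^sub>R \<nu>" for x
  define \<eta> where "\<eta> x = x \<bullet> \<nu> - \<phi> (\<pi> x)" for x
  define K where "K = 1 + L"
  have nn: "\<nu> \<bullet> \<nu> = 1" using nu by (simp add: dot_square_norm)
  have L: "0 \<le> L" using phi by (rule lipschitz_on_nonneg)
  have K: "1 \<le> K" using L by (simp add: K_def)
  have pi_H: "\<pi> x \<in> {y. y \<bullet> \<nu> = 0}" for x by (simp add: \<pi>_def inner_diff_left nn)
  have pi_shift: "\<pi> (x + t *\<^sub>R \<nu>) = \<pi> x" for x t
    by (simp add: \<pi>_def inner_add_left nn algebra_simps)
  have pi_dist: "dist (\<pi> x) (\<pi> y) \<le> dist x y" for x y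
  proof -
    let ?z = "x - y"
    have "(norm (?z - (?z \<bullet> \<nu>) *\<^sub>R \<nu>))\<^sup>2 = (norm ?z)\<^sup>2 - (?z \<bullet> \<nu>)\<^sup>2"
      by (simp only: power2_norm_eq_inner)
         (simp add: inner_diff_left inner_diff_right nn power2_eq_square inner_commute algebra_simps)
    then have "(norm (?z - (?z \<bullet> \<nu>) *\<^sub>R \<nu>))\<^sup>2 \<le> (norm ?z)\<^sup>2" by simp
    then have "norm (?z - (?z \<bullet> \<nu>) *\<^sub>R \<nu>) \<le> norm ?z" by (rule power2_le_imp_le) simp
    moreover have "\<pi> x - \<pi> y = ?z - (?z \<bullet> \<nu>) *\<^sub>R \<nu>"
      by (simp add: \<pi>_def inner_diff_left algebra_simps)
    ultimately show ?thesis by (simp add: dist_norm)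
  qed
  have phi_pi: "\<bar>\<phi> (\<pi> x) - \<phi> (\<pi> y)\<bar> \<le> L * dist (\<pi> x) (\<pi> y)" for x y
    using lipschitz_onD[OF phi pi_H pi_H, of x y] by (simp add: dist_real_def)
  have eta_lip: "\<bar>\<eta> x - \<eta> y\<bar> \<le> K * dist x y" for x y
  proof -
    have "\<bar>(x - y) \<bullet> \<nu>\<bar> \<le> dist x y"
      using Cauchy_Schwarz_ineq2[of "x - y" \<nu>] nu by (simp add: dist_norm)
    moreover have "L * dist (\<pi> x) (\<pi> y) \<le> L * dist x y"
      by (intro mult_left_mono pi_dist L)
    ultimately show ?thesis
      using phi_pi[of x y] by (simp add: \<eta>_def K_def inner_diff_left distrib_right)
  qed
  have eta_cont: "continuous_on UNIV \<eta>"
    by (rule lipschitz_on_continuous_on[of K])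
       (use eta_lip K in \<open>auto intro!: lipschitz_onI simp: dist_real_def\<close>)
  have pi_cont: "continuous_on UNIV \<pi>"
    unfolding \<pi>_def[abs_def] by (intro continuous_intros)
  have eta_shift: "\<eta> (x + t *\<^sub>R \<nu>) = \<eta> x + t" for x t
    by (simp add: \<eta>_def pi_shift inner_add_left nn)
  have in_Om: "x \<in> \<Omega> \<longleftrightarrow> 0 < \<eta> x" if "x \<in> ball p r" for x
  proof -
    have "x \<in> \<Omega> \<inter> ball p r \<longleftrightarrow> x \<in> {x \<in> ball p r. \<phi> (x - (x \<bullet> \<nu>) *\<^sub>R \<nu>) < x \<bullet> \<nu>}"
      by (simp only: graph)
    then show ?thesis using that by (simp add: \<eta>_def \<pi>_def)
  qed
  \<comment> \<open>A negative height would persist on a neighbourhood of a point in the closure of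
    \<Omega>, whereas \<Omega> has positive heights in the ball.\<close>
  have eta_frontier: "\<eta> y = 0" if y: "y \<in> frontier \<Omega>" "y \<in> ball p r" for y
  proof (rule antisym)
    have "y \<notin> \<Omega>" using y(1) Om'(2) by (simp add: frontier_def interior_open)
    then show "\<eta> y \<le> 0" using in_Om[OF y(2)] by simp
    show "0 \<le> \<eta> y"
    proof (rule ccontr)
      assume "\<not> 0 \<le> \<eta> y"
      moreover have "open {x. \<eta> x < 0}"
        by (intro open_Collect_less eta_cont continuous_intros)
      ultimately have "open ({x. \<eta> x < 0} \<inter> ball p r)" "y \<in> {x. \<eta> x < 0} \<inter> ball p r"
        using y by auto
      moreover have "y \<in> closure \<Omega>" using y by (simp add: frontier_def)
      ultimately have "\<Omega> \<inter> ({x. \<eta> x < 0} \<inter> ball p r) \<noteq> {}"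
        using open_Int_closure_eq_empty[of "{x. \<eta> x < 0} \<inter> ball p r" \<Omega>] by (auto simp: Int_commute)
      then show False using in_Om by fastforce
    qed
  qed
  have eta_p: "\<eta> p = 0" using eta_frontier[OF p] r by simp
  \<comment> \<open>From a point of the ball of radius r' there is room to descend to the graph, by
    at most K r', and frontier points outside the ball of radius r are at least r' away.\<close>
  define r' where "r' = r / (2 + K)"
  have r': "0 < r'" "(2 + K) * r' = r" using r K by (auto simp: r'_def)
  \<comment> \<open>Points of height below 2 a over the cylinder of radius a are within a + 2 a + L
    a of p, where L a bounds the variation of the graph; this is at most r'.\<close>
  define a where "a = min (min 1 A) (r' / (4 + K))"
  have a: "0 < a" "a \<le> 1" "a \<le> A" using A r' K by (auto simp: a_def)
  have "a \<le> r' / (4 + K)" by (simp add: a_def)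
  then have a_r: "(4 + K) * a \<le> r'" using K by (simp add: pos_le_divide_eq mult.commute)
  define Z where "Z = {x. dist (\<pi> x) (\<pi> p) < a}"
  have Z_open: "open Z"
    unfolding Z_def by (intro open_Collect_less pi_cont continuous_intros)
  have near: "dist p x < r'" if x: "x \<in> Z" "0 < \<eta> x" "\<eta> x < 2 * a" for x
  proof -
    have d: "dist (\<pi> x) (\<pi> p) < a" using x by (simp add: Z_def)
    have "L * dist (\<pi> x) (\<pi> p) \<le> L * a" using d L by (intro mult_left_mono) auto
    then have "\<bar>x \<bullet> \<nu> - p \<bullet> \<nu>\<bar> \<le> 2 * a + L * a"
      using x eta_p phi_pi[of x p] by (simp add: \<eta>_def)
    moreover have "x - p = (\<pi> x - \<pi> p) + (x \<bullet> \<nu> - p \<bullet> \<nu>) *\<^sub>R \<nu>"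
      by (simp add: \<pi>_def algebra_simps)
    then have "norm (x - p) \<le> norm (\<pi> x - \<pi> p) + \<bar>x \<bullet> \<nu> - p \<bullet> \<nu>\<bar>"
      using norm_triangle_ineq[of "\<pi> x - \<pi> p" "(x \<bullet> \<nu> - p \<bullet> \<nu>) *\<^sub>R \<nu>"] nu by simp
    ultimately have "dist p x < a + 2 * a + L * a"
      using d by (simp add: dist_norm norm_minus_commute)
    also have "\<dots> \<le> r'" using a_r a(1) by (simp add: K_def algebra_simps)
    finally show ?thesis .
  qed
  have r'_le: "r' \<le> (2 + K) * r'" using mult_right_mono[of 1 "2 + K" r'] r'(1) K by simp
  have chart: "boundary_chart \<Omega> Z (bdist \<Omega>) \<eta> \<nu> K a"
  proof
    show "\<Omega> \<in> sets borel" "Z \<in> sets borel" using Om' Z_open by auto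
    show "\<eta> \<in> borel_measurable borel" by (rule borel_measurable_continuous_onI[OF eta_cont])
    show "x + t *\<^sub>R \<nu> \<in> Z \<longleftrightarrow> x \<in> Z" for x t by (simp add: Z_def pi_shift)
    show "0 < bdist \<Omega> x" if "x \<in> \<Omega>" for x using bdist_pos Om' that by blast
    show "ball x (bdist \<Omega> x) \<subseteq> \<Omega>" if "x \<in> \<Omega>" for x using that by (rule ball_bdist_subset)
    fix x assume x: "x \<in> Z" "0 < \<eta> x" "\<eta> x < 2 * a"
    note n = near[OF x]
    have xb: "x \<in> ball p r" using n r'_le r'(2) by simp
    show "x \<in> \<Omega>" using in_Om[OF xb] x by simp
    have eta_le: "\<eta> x \<le> K * dist p x" using eta_lip[of x p] eta_p by (simp add: dist_commute)
    have "K * dist p x \<le> K * r'" using n K by (intro mult_left_mono) auto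
    then have eta_r': "\<eta> x \<le> K * r'" using eta_le by simp
    \<comment> \<open>The foot of x on the graph. It is not in \<Omega>, but its small translates
      along \<nu> are, so it is a frontier point.\<close>
    define y where "y = x + (- \<eta> x) *\<^sub>R \<nu>"
    have ey: "\<eta> y = 0" unfolding y_def eta_shift by simp
    have dxy: "dist x y = \<eta> x" using nu x by (simp add: y_def dist_norm)
    have dpy: "dist p y < r"
      using dist_triangle[of p y x] dxy n eta_r' r' by (simp add: algebra_simps)
    have "y \<in> closure \<Omega>"
      unfolding closure_approachable
    proof (intro allI impI)
      fix e :: real assume e: "0 < e"
      define t where "t = min e (r - dist p y) / 2"
      have t: "0 < t" "t < e" "t < r - dist p y" using e dpy by (auto simp: t_def)
      have "dist (y + t *\<^sub>R \<nu>) y = t" using nu t by (simp add: dist_norm)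
      moreover have "dist p (y + t *\<^sub>R \<nu>) < r"
        using dist_triangle[of p "y + t *\<^sub>R \<nu>" y] \<open>dist (y + t *\<^sub>R \<nu>) y = t\<close> t by (simp add: dist_commute)
      moreover have "\<eta> (y + t *\<^sub>R \<nu>) = t" unfolding eta_shift ey by simp
      ultimately show "\<exists>z\<in>\<Omega>. dist z y < e" 
        using in_Om[of "y + t *\<^sub>R \<nu>"] t by (intro bexI[of _ "y + t *\<^sub>R \<nu>"]) auto
    qed
    moreover have "y \<notin> \<Omega>" using in_Om[of y] dpy ey by simp
    ultimately have "y \<in> frontier \<Omega>" using Om'(2) by (simp add: frontier_def interior_open)
    then show "bdist \<Omega> x \<le> \<eta> x" using infdist_le[of y "frontier \<Omega>" x] dxy by (simp add: bdist_def)
    have "\<eta> x / K \<le> (INF z\<in>frontier \<Omega>. dist x z)"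
    proof (rule cINF_greatest)
      fix z assume z: "z \<in> frontier \<Omega>"
      show "\<eta> x / K \<le> dist x z"
      proof (cases "z \<in> ball p r")
        case True
        then show ?thesis
          using eta_lip[of x z] eta_frontier[OF z True] x K by (simp add: field_simps)
      next
        case False
        have "\<eta> x / K \<le> r'" using eta_r' K by (simp add: pos_divide_le_eq mult.commute)
        moreover have "r \<le> dist p x + dist x z" using dist_triangle[of p z x] False by simp
        moreover have "2 * r' \<le> (2 + K) * r'" using r' K by (intro mult_right_mono) auto
        then have "r' + r' \<le> r" using r'(2) by linarith
        ultimately show ?thesis using n by simp
      qed
    qed (use Om' in simp)
    then have "\<eta> x / K \<le> bdist \<Omega> x" using Om'(4) by (simp add: bdist_def infdist_notempty)
    then show "\<eta> x \<le> K * bdist \<Omega> x" using K by (simp add: pos_divide_le_eq mult.commute)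
  qed (use nu K a eta_shift bdist_lipschitz in auto)
  \<comment> \<open>Within a / K of p the K-Lipschitz height, which is 0 at p, stays below
    a.\<close>
  define \<rho> where "\<rho> = a / K"
  have rho: "0 < \<rho>" "K * \<rho> = a" "\<rho> \<le> a" using a K by (auto simp: \<rho>_def field_simps)
  have "a \<le> (4 + K) * a" using a K by simp
  then have "\<rho> \<le> r" using rho a_r r'_le r'(2) by linarith
  have "\<Omega> \<inter> ball p \<rho> \<subseteq> {x\<in>Z. 0 < \<eta> x \<and> \<eta> x < a}"
  proof
    fix x assume x: "x \<in> \<Omega> \<inter> ball p \<rho>"
    then have d: "dist p x < \<rho>" by simp
    have "\<eta> x \<le> K * dist p x" using eta_lip[of x p] eta_p by (simp add: dist_commute)
    also have "\<dots> < K * \<rho>" using d K by simp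
    finally have "\<eta> x < a" using rho by simp
    moreover have "0 < \<eta> x" using in_Om[of x] x \<open>\<rho> \<le> r\<close> by simp
    moreover have "x \<in> Z" using pi_dist[of x p] d rho by (simp add: Z_def dist_commute)
    ultimately show "x \<in> {x\<in>Z. 0 < \<eta> x \<and> \<eta> x < a}" by simp
  qed
  moreover have "p \<in> Z" using a by (simp add: Z_def)
  ultimately show thesis using that chart a(3) rho(1) Z_open eta_cont eta_p by blast
qed

text \<open>Finitely many charts cover a neighbourhood of the compact frontier; on the rest of
  \<Omega> the integrand is at most a multiple of |u|. The constant is quantified before R, m, s and
  u.\<close>

lemma hardy_borel:
  fixes \<Omega> :: "(real^'n) set"
  assumes Om: "bounded_Lipschitz_domain \<Omega>"
  shows "\<exists>C>0. \<forall>R m s u. 0 < R \<longrightarrow> (\<forall>x\<in>\<Omega>. bdist \<Omega> x < R) \<longrightarrow> 0 \<le> s \<longrightarrow> s < 1 \<longrightarrow>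
    u \<in> borel_measurable borel \<longrightarrow> (\<integral>\<^sup>+x. indicator \<Omega> x * ennreal \<bar>u x\<bar> \<partial>lborel) < \<infinity> \<longrightarrow>
    (\<integral>\<^sup>+x. indicator \<Omega> x * ennreal (\<bar>u x\<bar> / bdist \<Omega> x powr s
        * log_weight (Suc m) (bdist \<Omega> x / R)) \<partial>lborel)
      \<le> ennreal C * (ennreal (1 - s) * gagliardo \<Omega> s u
          + (\<integral>\<^sup>+x. indicator \<Omega> x * ennreal \<bar>u x\<bar> \<partial>lborel))"
proof -
  note Om' = bounded_Lipschitz_domainD[OF Om]
  have [measurable]: "\<Omega> \<in> sets borel" using Om' by simp
  obtain x0 where x0: "x0 \<in> \<Omega>" using Om' by blast
  \<comment> \<open>A reference scale depending on \<Omega> alone. Every admissible R exceeds it, so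
    where \<delta> < r the weight at \<delta>/R is at most the weight at \<delta>/r, and the charts
    are built for r only.\<close>
  define r where "r = bdist \<Omega> x0"
  have r: "0 < r" using bdist_pos Om' x0 by (auto simp: r_def)
  define h where "h m s u x = \<bar>u x\<bar> / bdist \<Omega> x powr s * log_weight (Suc m) (bdist \<Omega> x / r)"
    for m s and u :: "real^'n \<Rightarrow> real" and x
  define N where "N u = (\<integral>\<^sup>+x. indicator \<Omega> x * ennreal \<bar>u x\<bar> \<partial>lborel)" for u :: "real^'n \<Rightarrow> real"
  \<comment> \<open>Everything a boundary point contributes, bundled into one predicate so that
    \<rho> and C can be chosen as functions of p.\<close>
  define good where "good p \<rho> C \<longleftrightarrow> 0 < \<rho> \<and> 0 \<le> C \<and> (\<forall>x\<in>\<Omega> \<inter> ball p \<rho>. bdist \<Omega> x < r) \<and>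
     (\<forall>m s u. 0 \<le> s \<longrightarrow> s < 1 \<longrightarrow> u \<in> borel_measurable borel \<longrightarrow> N u < \<infinity> \<longrightarrow>
       (\<integral>\<^sup>+x. indicator (\<Omega> \<inter> ball p \<rho>) x * ennreal (h m s u x) \<partial>lborel)
         \<le> ennreal C * (ennreal (1 - s) * gagliardo \<Omega> s u + N u))" for p \<rho> C
  have "\<forall>p\<in>frontier \<Omega>. \<exists>\<rho> C. good p \<rho> C"
  proof
    fix p assume p: "p \<in> frontier \<Omega>"
    have r2: "0 < r / 2" using r by simp
    obtain Z \<eta> \<nu> K a \<rho>
      where chart: "boundary_chart \<Omega> Z (bdist \<Omega>) \<eta> \<nu> K a" and a_le: "a \<le> r / 2"
        and rho: "0 < \<rho>" "\<Omega> \<inter> ball p \<rho> \<subseteq> {x\<in>Z. 0 < \<eta> x \<and> \<eta> x < a}"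
      by (rule boundary_chart_exists[OF Om p r2]) (rule that)
    interpret boundary_chart \<Omega> Z "bdist \<Omega>" \<eta> \<nu> K a by (rule chart)
    define c where "c = osc_const * (8 * 64 ^ CARD('n))"
    have c: "0 \<le> c" using osc_const_pos by (simp add: c_def)
    define C where "C = 64 * K\<^sup>2 * max (1 / a) c"
    have C: "0 \<le> C" using c by (simp add: C_def)
    have "(\<integral>\<^sup>+x. indicator (\<Omega> \<inter> ball p \<rho>) x * ennreal (h m s u x) \<partial>lborel)
         \<le> ennreal C * (ennreal (1 - s) * gagliardo \<Omega> s u + N u)"
      if s: "0 \<le> s" "s < 1" and [measurable]: "u \<in> borel_measurable borel" and fin: "N u < \<infinity>" for m s u
    proof -
      have "(\<integral>\<^sup>+x. indicator (\<Omega> \<inter> ball p \<rho>) x * ennreal (h m s u x) \<partial>lborel)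
          \<le> (\<integral>\<^sup>+x. indicator {x\<in>Z. 0 < \<eta> x \<and> \<eta> x < a} x * ennreal (h m s u x) \<partial>lborel)"
        using rho(2) by (intro nn_integral_mono mult_right_mono) (auto split: split_indicator)
      also have "\<dots> \<le> ennreal (64 * K\<^sup>2) * (ennreal (1 / a) * N u + ennreal (c * (1 - s)) * gagliardo \<Omega> s u)"
        using chart_hardy[of u s r m] s fin a_le unfolding h_def N_def c_def by simp
      also have "\<dots> \<le> ennreal (64 * K\<^sup>2) * (ennreal (max (1 / a) c) * N u
          + ennreal (max (1 / a) c) * (ennreal (1 - s) * gagliardo \<Omega> s u))"
      proof (intro mult_left_mono add_mono)
        show "ennreal (1 / a) * N u \<le> ennreal (max (1 / a) c) * N u"
          by (intro mult_right_mono ennreal_leI) auto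
        have "ennreal (c * (1 - s)) = ennreal c * ennreal (1 - s)" using c s by (intro ennreal_mult) auto
        then show "ennreal (c * (1 - s)) * gagliardo \<Omega> s u
            \<le> ennreal (max (1 / a) c) * (ennreal (1 - s) * gagliardo \<Omega> s u)"
          by (simp only: mult.assoc) (intro mult_right_mono ennreal_leI, auto)
      qed simp
      also have "\<dots> = ennreal C * (ennreal (1 - s) * gagliardo \<Omega> s u + N u)"
      proof -
        have "ennreal C = ennreal (64 * K\<^sup>2) * ennreal (max (1 / a) c)"
          unfolding C_def using c by (intro ennreal_mult) auto
        then show ?thesis by (simp only: distrib_left[symmetric] mult.assoc add.commute)
      qed
      finally show ?thesis .
    qed
    moreover have "\<forall>x\<in>\<Omega> \<inter> ball p \<rho>. bdist \<Omega> x < r"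
    proof
      fix x assume "x \<in> \<Omega> \<inter> ball p \<rho>"
      then have x: "x \<in> Z" "0 < \<eta> x" "\<eta> x < a" using rho by auto
      then show "bdist \<Omega> x < r" using delta_le[of x] a a_le r by auto
    qed
    ultimately have "good p \<rho> C" unfolding good_def using rho(1) C by blast
    then show "\<exists>\<rho> C. good p \<rho> C" by blast
  qed
  then obtain \<rho> C where good: "\<And>p. p \<in> frontier \<Omega> \<Longrightarrow> good p (\<rho> p) (C p)" by metis
  have rho: "0 < \<rho> p" and C: "0 \<le> C p"
    and small: "x \<in> \<Omega> \<inter> ball p (\<rho> p) \<Longrightarrow> bdist \<Omega> x < r" if "p \<in> frontier \<Omega>" for p x
    using good[OF that] unfolding good_def by blast+
  have loc: "(\<integral>\<^sup>+x. indicator (\<Omega> \<inter> ball p (\<rho> p)) x * ennreal (h m s u x) \<partial>lborel)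
      \<le> ennreal (C p) * (ennreal (1 - s) * gagliardo \<Omega> s u + N u)"
    if "p \<in> frontier \<Omega>" "0 \<le> s" "s < 1" "u \<in> borel_measurable borel" "N u < \<infinity>" for p m s u
    using good[OF that(1)] that(2-) unfolding good_def by blast
  have comp: "compact (frontier \<Omega>)" by (rule compact_frontier_bounded[OF Om'(3)])
  obtain P where P: "P \<subseteq> frontier \<Omega>" "finite P" "frontier \<Omega> \<subseteq> (\<Union>p\<in>P. ball p (\<rho> p))"
    using compactE_image[OF comp, of "frontier \<Omega>" "\<lambda>p. ball p (\<rho> p)"] rho by force
  let ?U = "\<Union>p\<in>P. ball p (\<rho> p)"
  \<comment> \<open>The compact frontier is disjoint from the closed complement of the cover, hence
    at positive distance from it; points closer than d to the frontier are covered.\<close>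
  obtain d where d: "0 < d" "\<And>x y. x \<in> frontier \<Omega> \<Longrightarrow> y \<in> - ?U \<Longrightarrow> d \<le> dist x y"
  proof -
    have "closed (- ?U)" by (intro closed_Compl open_UN ballI open_ball)
    moreover have "frontier \<Omega> \<inter> - ?U = {}" using P(3) by blast
    ultimately show ?thesis
      using separate_compact_closed[OF comp, of "- ?U"] that by blast
  qed
  have cover: "x \<in> ?U" if "bdist \<Omega> x < d" for x
  proof (rule ccontr)
    assume "x \<notin> ?U"
    then have "d \<le> (INF z\<in>frontier \<Omega>. dist x z)"
      using d(2)[of _ x] Om' by (intro cINF_greatest) (auto simp: dist_commute)
    then show False using that Om' by (simp add: bdist_def infdist_notempty)
  qed
  \<comment> \<open>The cap at 1 makes b \<le> b^s, so that 1 / \<delta>^s \<le> 1 / b away from the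
    boundary for all s at once.\<close>
  define b where "b = min 1 d"
  have b: "0 < b" "b \<le> 1" using d by (auto simp: b_def)
  define C' where "C' = (\<Sum>p\<in>P. C p) + 1 / b"
  have sumC: "0 \<le> (\<Sum>p\<in>P. C p)" using C P(1) by (intro sum_nonneg) auto
  then have C': "0 < C'" using b by (auto simp: C'_def intro: add_nonneg_pos)
  show ?thesis
  proof (intro exI conjI allI impI)
    show "0 < C'" by fact
    fix R s :: real and m :: nat and u :: "real^'n \<Rightarrow> real"
    assume R: "0 < R" "\<forall>x\<in>\<Omega>. bdist \<Omega> x < R" and s: "0 \<le> s" "s < 1"
      and u[measurable]: "u \<in> borel_measurable borel"
      and "(\<integral>\<^sup>+x. indicator \<Omega> x * ennreal \<bar>u x\<bar> \<partial>lborel) < \<infinity>"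
    then have fin: "N u < \<infinity>" by (simp add: N_def)
    have rR: "r < R" using R x0 by (auto simp: r_def)
    let ?f = "\<lambda>x. \<bar>u x\<bar> / bdist \<Omega> x powr s * log_weight (Suc m) (bdist \<Omega> x / R)"
    have [measurable]: "(\<lambda>x. h m s u x) \<in> borel_measurable borel" unfolding h_def by measurable
    have [measurable]: "\<Omega> \<inter> ball p (\<rho> p) \<in> sets borel" for p by simp
    have point: "indicator \<Omega> x * ennreal (?f x) \<le>
        (\<Sum>p\<in>P. indicator (\<Omega> \<inter> ball p (\<rho> p)) x * ennreal (h m s u x))
        + ennreal (1 / b) * (indicator \<Omega> x * ennreal \<bar>u x\<bar>)" for x
    proof (cases "x \<in> \<Omega>")
      case True
      have dx: "0 < bdist \<Omega> x" using bdist_pos Om' True by blast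
      show ?thesis
      proof (cases "x \<in> ?U")
        case in_U: True
        then obtain p where p: "p \<in> P" "x \<in> ball p (\<rho> p)" by blast
        have "bdist \<Omega> x < r" using small[of p x] p P(1) True by blast
        then have "log_weight (Suc m) (bdist \<Omega> x / R) \<le> log_weight (Suc m) (bdist \<Omega> x / r)"
          using dx r rR R by (intro log_weight_mono divide_left_mono) auto
        then have "?f x \<le> h m s u x" unfolding h_def by (intro mult_left_mono) auto
        then have "ennreal (?f x) \<le> ennreal (h m s u x)" by (rule ennreal_leI)
        also have "\<dots> = indicator (\<Omega> \<inter> ball p (\<rho> p)) x * ennreal (h m s u x)" using p True by simp
        also have "\<dots> \<le> (\<Sum>p\<in>P. indicator (\<Omega> \<inter> ball p (\<rho> p)) x * ennreal (h m s u x))"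
          using p P(2) by (intro member_le_sum) auto
        finally show ?thesis using True by (auto intro: add_increasing2)
      next
        case False
        then have "d \<le> bdist \<Omega> x" using cover[of x] by force
        then have bx: "b \<le> bdist \<Omega> x" by (simp add: b_def)
        have "b powr 1 \<le> b powr s" using b s by (intro powr_mono') auto
        also have "\<dots> \<le> bdist \<Omega> x powr s" using b s bx by (intro powr_mono2) auto
        finally have "b \<le> bdist \<Omega> x powr s" using b by simp
        then have "\<bar>u x\<bar> / bdist \<Omega> x powr s \<le> \<bar>u x\<bar> / b"
          using b dx by (intro divide_left_mono mult_pos_pos) auto
        moreover have "log_weight (Suc m) (bdist \<Omega> x / R) \<le> 1"
          using dx R True by (intro log_weight_le_1) auto
        ultimately have "?f x \<le> \<bar>u x\<bar> / b * 1"
          using dx R True b by (intro mult_mono) (auto intro!: less_imp_le[OF log_weight_pos])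
        then have "ennreal (?f x) \<le> ennreal (1 / b * \<bar>u x\<bar>)" by (intro ennreal_leI) simp
        also have "\<dots> = ennreal (1 / b) * ennreal \<bar>u x\<bar>" using b by (intro ennreal_mult) auto
        finally show ?thesis using True by (auto intro: add_increasing)
      qed
    qed simp
    let ?X = "ennreal (1 - s) * gagliardo \<Omega> s u + N u"
    have "(\<integral>\<^sup>+x. indicator \<Omega> x * ennreal (?f x) \<partial>lborel)
        \<le> (\<integral>\<^sup>+x. (\<Sum>p\<in>P. indicator (\<Omega> \<inter> ball p (\<rho> p)) x * ennreal (h m s u x))
        + ennreal (1 / b) * (indicator \<Omega> x * ennreal \<bar>u x\<bar>) \<partial>lborel)"
      by (intro nn_integral_mono point)
    also have "\<dots> = (\<Sum>p\<in>P. \<integral>\<^sup>+x. indicator (\<Omega> \<inter> ball p (\<rho> p)) x * ennreal (h m s u x) \<partial>lborel)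
        + ennreal (1 / b) * N u"
      unfolding N_def by (simp add: nn_integral_add nn_integral_sum nn_integral_cmult)
    also have "\<dots> \<le> (\<Sum>p\<in>P. ennreal (C p) * ?X) + ennreal (1 / b) * ?X"
      using P(1) s u fin
      by (intro add_mono sum_mono loc mult_left_mono) (auto intro: add_increasing)
    also have "\<dots> = ennreal C' * ?X"
    proof -
      have "(\<Sum>p\<in>P. ennreal (C p) * ?X) = ennreal (\<Sum>p\<in>P. C p) * ?X"
        using C P(1) by (subst sum_ennreal[symmetric]) (auto simp: sum_distrib_right)
      then show ?thesis
        unfolding C'_def using sumC b by (subst ennreal_plus) (auto simp: distrib_right)
    qed
    finally show "(\<integral>\<^sup>+x. indicator \<Omega> x * ennreal (?f x) \<partial>lborel)
        \<le> ennreal C' * (ennreal (1 - s) * gagliardo \<Omega> s u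
          + (\<integral>\<^sup>+x. indicator \<Omega> x * ennreal \<bar>u x\<bar> \<partial>lborel))"
      by (simp add: N_def)
  qed
qed

section \<open>From Lebesgue measurable functions on the domain to Borel functions on the whole
  space\<close>

lemma nn_integral_lebesgue_on_cong_AE:
  fixes f g :: "'a::euclidean_space \<Rightarrow> ennreal"
  assumes "\<Omega> \<in> sets borel" "AE x in lborel. x \<in> \<Omega> \<longrightarrow> f x = g x"
  shows "(\<integral>\<^sup>+x. f x \<partial>lebesgue_on \<Omega>) = (\<integral>\<^sup>+x. indicator \<Omega> x * g x \<partial>lborel)"
proof -
  have "(\<integral>\<^sup>+x. f x \<partial>lebesgue_on \<Omega>) = (\<integral>\<^sup>+x. f x * indicator \<Omega> x \<partial>lborel)"
    using assms(1) by (simp add: nn_integral_restrict_space nn_integral_completion)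
  also have "\<dots> = (\<integral>\<^sup>+x. indicator \<Omega> x * g x \<partial>lborel)"
    using assms(2) by (intro nn_integral_cong_AE) (auto split: split_indicator)
  finally show ?thesis .
qed

text \<open>The estimates rest on Fubini for Borel functions, whereas an element of
  \<open>W_space\<close> is only Lebesgue measurable on \<Omega>. A Borel function that agrees with
  it almost everywhere on \<Omega> leaves all the integrals involved unchanged.\<close>

lemma W_space_borel_representative:
  fixes \<Omega> :: "(real^'n) set"
  assumes Om: "open \<Omega>" and u: "u \<in> W_space s \<Omega>"
  obtains g where "g \<in> borel_measurable borel"
    "L1_norm \<Omega> u = (\<integral>\<^sup>+x. indicator \<Omega> x * ennreal \<bar>g x\<bar> \<partial>lborel)"
    "W_seminorm s \<Omega> u = gagliardo \<Omega> s g"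
    "\<And>R m. hardy_integral R m s \<Omega> u = (\<integral>\<^sup>+x. indicator \<Omega> x *
      ennreal (\<bar>g x\<bar> / bdist \<Omega> x powr s * log_weight m (bdist \<Omega> x / R)) \<partial>lborel)"
    "L1_norm \<Omega> u < \<infinity>"
proof -
  have B: "\<Omega> \<in> sets borel" using Om by simp
  have int: "integrable (lebesgue_on \<Omega>) u" using u by (simp add: W_space_def)
  have "(\<lambda>x. if x \<in> \<Omega> then u x else 0) \<in> borel_measurable lebesgue"
    using int B by (intro borel_measurable_if_I borel_measurable_integrable) auto
  then obtain g where g: "g \<in> borel_measurable lborel"
      "AE x in lborel. (if x \<in> \<Omega> then u x else 0) = g x"
    using completion_ex_borel_measurable_real by blast
  have ae: "AE x in lborel. x \<in> \<Omega> \<longrightarrow> u x = g x" using g(2) by eventually_elim auto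
  show thesis
  proof
    show "g \<in> borel_measurable borel" using g by simp
    show "L1_norm \<Omega> u = (\<integral>\<^sup>+x. indicator \<Omega> x * ennreal \<bar>g x\<bar> \<partial>lborel)"
      unfolding L1_norm_def using ae
      by (intro nn_integral_lebesgue_on_cong_AE B) (auto elim: eventually_mono)
    show "hardy_integral R m s \<Omega> u = (\<integral>\<^sup>+x. indicator \<Omega> x *
      ennreal (\<bar>g x\<bar> / bdist \<Omega> x powr s * log_weight m (bdist \<Omega> x / R)) \<partial>lborel)" for R m
      unfolding hardy_integral_def using ae
      by (intro nn_integral_lebesgue_on_cong_AE B) (auto elim: eventually_mono)
    show "L1_norm \<Omega> u < \<infinity>"
      unfolding L1_norm_def using int by (auto simp: integrable_iff_bounded)
    have "(\<integral>\<^sup>+y. ennreal (\<bar>u x - u y\<bar> / norm (x - y) powr (real CARD('n) + s)) \<partial>lebesgue_on \<Omega>)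
       = (\<integral>\<^sup>+y. indicator \<Omega> y * ennreal (\<bar>g x - g y\<bar> / norm (x - y) powr (real CARD('n) + s)) \<partial>lborel)"
      if "u x = g x" for x
      unfolding that[symmetric] using ae
      by (intro nn_integral_lebesgue_on_cong_AE B) (auto elim: eventually_mono)
    then have "W_seminorm s \<Omega> u = (\<integral>\<^sup>+x. indicator \<Omega> x *
       (\<integral>\<^sup>+y. indicator \<Omega> y * ennreal (\<bar>g x - g y\<bar> / norm (x - y) powr (real CARD('n) + s)) \<partial>lborel) \<partial>lborel)"
      unfolding W_seminorm_def using ae
      by (intro nn_integral_lebesgue_on_cong_AE B) (auto elim!: eventually_mono)
    also have "\<dots> = gagliardo \<Omega> s g"
      unfolding gagliardo_def using g(1) B
      by (intro nn_integral_cong) (auto simp: nn_integral_cmult)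
    finally show "W_seminorm s \<Omega> u = gagliardo \<Omega> s g" .
  qed
qed

lemma hardy_uniform:
  fixes \<Omega> :: "(real^'n) set"
  assumes Om: "bounded_Lipschitz_domain \<Omega>"
  obtains C :: real where "0 < C"
    "\<And>R m s u. 0 < R \<Longrightarrow> \<forall>x\<in>\<Omega>. bdist \<Omega> x < R \<Longrightarrow> 1 \<le> m \<Longrightarrow> 0 \<le> s \<Longrightarrow> s < 1 \<Longrightarrow> u \<in> W_space s \<Omega> \<Longrightarrow>
      hardy_integral R m s \<Omega> u \<le> ennreal C * (ennreal (1 - s) * W_seminorm s \<Omega> u + L1_norm \<Omega> u)"
proof -
  obtain C where C: "0 < C" and *: "\<And>R m s u. 0 < R \<Longrightarrow> (\<forall>x\<in>\<Omega>. bdist \<Omega> x < R) \<Longrightarrow> 0 \<le> s \<Longrightarrow> s < 1 \<Longrightarrow>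
    u \<in> borel_measurable borel \<Longrightarrow> (\<integral>\<^sup>+x. indicator \<Omega> x * ennreal \<bar>u x\<bar> \<partial>lborel) < \<infinity> \<Longrightarrow>
    (\<integral>\<^sup>+x. indicator \<Omega> x * ennreal (\<bar>u x\<bar> / bdist \<Omega> x powr s
        * log_weight (Suc m) (bdist \<Omega> x / R)) \<partial>lborel)
      \<le> ennreal C * (ennreal (1 - s) * gagliardo \<Omega> s u
          + (\<integral>\<^sup>+x. indicator \<Omega> x * ennreal \<bar>u x\<bar> \<partial>lborel))"
    using hardy_borel[OF Om] by blast
  show thesis
  proof (rule that[OF C])
    fix R s :: real and m :: nat and u :: "real^'n \<Rightarrow> real"
    assume R: "0 < R" "\<forall>x\<in>\<Omega>. bdist \<Omega> x < R" and m: "1 \<le> m" and s: "0 \<le> s" "s < 1" and u: "u \<in> W_space s \<Omega>"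
    obtain k where k: "m = Suc k" using m by (cases m) auto
    obtain g where g: "g \<in> borel_measurable borel"
      "L1_norm \<Omega> u = (\<integral>\<^sup>+x. indicator \<Omega> x * ennreal \<bar>g x\<bar> \<partial>lborel)"
      "W_seminorm s \<Omega> u = gagliardo \<Omega> s g"
      "\<And>R m. hardy_integral R m s \<Omega> u = (\<integral>\<^sup>+x. indicator \<Omega> x *
        ennreal (\<bar>g x\<bar> / bdist \<Omega> x powr s * log_weight m (bdist \<Omega> x / R)) \<partial>lborel)"
      "L1_norm \<Omega> u < \<infinity>"
      using W_space_borel_representative[OF bounded_Lipschitz_domainD(2)[OF Om] u] by blast
    show "hardy_integral R m s \<Omega> u \<le> ennreal C * (ennreal (1 - s) * W_seminorm s \<Omega> u + L1_norm \<Omega> u)"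
      using *[OF R s g(1), of k] g(5) unfolding g(2-4) k by blast
  qed
qed

section \<open>Divergence of the series\<close>

text \<open>As p has height 0, the point p + \<nu>/2 has height 1/2 and a whole ball around it lies
  in the slice. This makes the cross-section factor of \<open>nn_integral_line_coarea\<close>
  positive.\<close>

lemma (in boundary_chart) chart_volume_pos:
  assumes "open Z" "continuous_on UNIV \<eta>" "p \<in> Z" "\<eta> p = 0"
  obtains c where "0 < c" "ennreal c \<le> emeasure lborel {x\<in>Z. 0 \<le> \<eta> x \<and> \<eta> x < 1}"
proof -
  let ?W = "Z \<inter> ({x. 0 < \<eta> x} \<inter> {x. \<eta> x < 1})"
  have "open ?W"
    using assms by (intro open_Int open_Collect_less continuous_intros) auto
  moreover have "p + (1/2) *\<^sub>R \<nu> \<in> ?W" using assms by (simp add: cyl shift)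
  ultimately obtain e where e: "0 < e" "ball (p + (1/2) *\<^sub>R \<nu>) e \<subseteq> ?W"
    by (meson openE)
  let ?c = "unit_ball_vol (real DIM('a)) * e ^ DIM('a)"
  have "ennreal ?c = emeasure lborel (ball (p + (1/2) *\<^sub>R \<nu>) e)"
    using e by (simp add: emeasure_ball)
  also have "\<dots> \<le> emeasure lborel {x\<in>Z. 0 \<le> \<eta> x \<and> \<eta> x < 1}"
    using e(2) by (intro emeasure_mono) auto
  finally show thesis using that[of ?c] e by simp
qed

text \<open>The case u = 1. For t \<ge> e one has t^(-s) \<ge> e^(1-s) / t, which turns the height
  integral into that of the derivative of \<open>log_L (Suc m)\<close>. Since \<eta> / (K R) \<le>
  \<delta> / R and \<delta> \<le> \<eta>, the integrand in terms of \<eta> with K R in place of R is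
  a lower bound.\<close>

lemma (in boundary_chart) chart_weight_integral_ge:
  assumes s: "0 \<le> s" "s < 1" and R: "2 * a \<le> R" and e: "0 < e" "e < a / 2"
    and c: "0 < c" "ennreal c \<le> emeasure lborel {x\<in>Z. 0 \<le> \<eta> x \<and> \<eta> x < 1}"
  shows "ennreal (c * (e powr (1 - s) *
      (log_L (Suc m) (a / 2 / (K * R)) - log_L (Suc m) (e / (K * R)))))
    \<le> (\<integral>\<^sup>+x. indicator \<Omega> x * ennreal (1 / \<delta> x powr s * log_weight (Suc m) (\<delta> x / R)) \<partial>lborel)"
proof -
  define r where "r = K * R"
  have R0: "0 < R" using R a by linarith
  have "1 * R \<le> K * R" using K R0 by (intro mult_right_mono) auto
  then have r: "0 < r" "2 * a \<le> r" unfolding r_def using R R0 by linarith+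
  define f where "f t = indicator {0<..<a} t * ennreal (t powr -s * log_weight (Suc m) (t / r))" for t
  have [measurable]: "f \<in> borel_measurable borel" unfolding f_def[abs_def] by measurable
  have t1: "0 < t / r" "t / r < 1" if "0 < t" "t < a" for t using that r a by (auto simp: pos_divide_less_eq)
  define I where "I = log_L (Suc m) (a / 2 / r) - log_L (Suc m) (e / r)"
  have FTC: "(\<integral>\<^sup>+t. ennreal (log_weight (Suc m) (t / r) / t) * indicator {e..a/2} t \<partial>lborel) = ennreal I"
    unfolding I_def
  proof (rule nn_integral_FTC_Icc[where F = "\<lambda>t. log_L (Suc m) (t / r)"])
    show "(\<lambda>t. log_weight (Suc m) (t / r) / t) \<in> borel_measurable borel" by measurable
    fix t assume "t \<in> {e..a/2}"
    then have t': "0 < t" "t < a" using e a by auto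
    have "((\<lambda>t. log_L (Suc m) (t / r)) has_real_derivative
        (log_weight (Suc m) (t / r) / (t / r)) * (1 / r)) (at t)"
      by (rule DERIV_chain2[where f = "log_L (Suc m)" and g = "\<lambda>t. t / r", OF DERIV_log_L[OF t1[OF t']]])
         (use r in \<open>auto intro!: derivative_eq_intros\<close>)
    moreover have "(log_weight (Suc m) (t / r) / (t / r)) * (1 / r) = log_weight (Suc m) (t / r) / t"
      using r by simp
    ultimately show "((\<lambda>t. log_L (Suc m) (t / r)) has_real_derivative log_weight (Suc m) (t / r) / t) (at t)"
      by simp
    show "0 \<le> log_weight (Suc m) (t / r) / t"
      using log_weight_pos[OF t1[OF t'], of "Suc m"] t' by simp
  qed (use e in auto)
  \<comment> \<open>\<open>ennreal\<close> sends negative numbers to 0, so the splitting holds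
    whatever the sign of \<open>I\<close>.\<close>
  have "ennreal (c * (e powr (1 - s) * I)) = ennreal c * (ennreal (e powr (1 - s)) * ennreal I)"
    using c by (cases "0 \<le> I") (auto simp: ennreal_mult ennreal_neg mult_nonneg_nonpos)
  also have "\<dots> = ennreal c * (\<integral>\<^sup>+t. ennreal (e powr (1 - s)) *
      (ennreal (log_weight (Suc m) (t / r) / t) * indicator {e..a/2} t) \<partial>lborel)"
    unfolding FTC[symmetric] by (subst nn_integral_cmult) auto
  also have "\<dots> \<le> ennreal c * (\<integral>\<^sup>+t. f t \<partial>lborel)"
  proof (intro mult_left_mono nn_integral_mono)
    fix t
    show "ennreal (e powr (1 - s)) * (ennreal (log_weight (Suc m) (t / r) / t) * indicator {e..a/2} t) \<le> f t"
    proof (cases "t \<in> {e..a/2}")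
      case True
      then have t: "0 < t" "t < a" using e a by auto
      have "e powr (1 - s) \<le> t powr (1 - s)" using e True s by (intro powr_mono2) auto
      also have "\<dots> = t * t powr -s" using t by (simp add: powr_diff powr_minus_divide)
      finally have "e powr (1 - s) * (log_weight (Suc m) (t / r) / t) \<le> t * t powr -s * (log_weight (Suc m) (t / r) / t)"
        using log_weight_pos[OF t1[OF t], of "Suc m"] t by (intro mult_right_mono) auto
      also have "\<dots> = t powr -s * log_weight (Suc m) (t / r)" using t by simp
      finally have "ennreal (e powr (1 - s) * (log_weight (Suc m) (t / r) / t))
          \<le> ennreal (t powr -s * log_weight (Suc m) (t / r))" by (rule ennreal_leI)
      moreover have "ennreal (e powr (1 - s) * (log_weight (Suc m) (t / r) / t))
          = ennreal (e powr (1 - s)) * ennreal (log_weight (Suc m) (t / r) / t)"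
        using log_weight_pos[OF t1[OF t], of "Suc m"] t by (intro ennreal_mult) auto
      ultimately show ?thesis using True t by (simp add: f_def)
    qed simp
  qed simp
  also have "\<dots> \<le> emeasure lborel {x\<in>Z. 0 \<le> \<eta> x \<and> \<eta> x < 1} * (\<integral>\<^sup>+t. f t \<partial>lborel)"
    by (intro mult_right_mono c) simp
  also have "\<dots> = (\<integral>\<^sup>+x. indicator Z x * f (\<eta> x) \<partial>lborel)"
    by (rule nn_integral_line_coarea[symmetric]) (use shift cyl in auto)
  also have "\<dots> \<le> (\<integral>\<^sup>+x. indicator \<Omega> x * ennreal (1 / \<delta> x powr s * log_weight (Suc m) (\<delta> x / R)) \<partial>lborel)"
  proof (rule nn_integral_mono)
    fix x
    show "indicator Z x * f (\<eta> x)
        \<le> indicator \<Omega> x * ennreal (1 / \<delta> x powr s * log_weight (Suc m) (\<delta> x / R))"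
    proof (cases "x \<in> Z \<and> 0 < \<eta> x \<and> \<eta> x < a")
      case True
      then have x: "x \<in> Z" "0 < \<eta> x" "\<eta> x < 2 * a" and xa: "\<eta> x < a" using a by auto
      have xO: "x \<in> \<Omega>" using in_Om[OF x] .
      note d = delta_pos[OF xO] delta_le[OF x] delta_ge[OF x]
      have "\<eta> x / r \<le> \<delta> x / R" using d K R0 by (simp add: r_def field_simps)
      moreover have "\<delta> x / R < 1" using d xa R a R0 by simp
      ultimately have "log_weight (Suc m) (\<eta> x / r) \<le> log_weight (Suc m) (\<delta> x / R)"
        using t1[OF x(2) xa] by (intro log_weight_mono) auto
      moreover have "\<eta> x powr -s \<le> \<delta> x powr -s" using d s by (intro powr_mono2') auto
      ultimately have "\<eta> x powr -s * log_weight (Suc m) (\<eta> x / r)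
          \<le> 1 / \<delta> x powr s * log_weight (Suc m) (\<delta> x / R)"
        using log_weight_pos[OF t1[OF x(2) xa], of "Suc m"] by (intro mult_mono) (auto simp: powr_minus_divide)
      then show ?thesis using True xO by (simp add: f_def ennreal_leI)
    next
      case False
      then have "indicator Z x * f (\<eta> x) = 0" by (auto simp: f_def split: split_indicator)
      then show ?thesis by (simp only: zero_le)
    qed
  qed
  finally show ?thesis by (simp add: I_def r_def)
qed

lemma const_in_W_space:
  fixes \<Omega> :: "(real^'n) set"
  assumes "open \<Omega>" "bounded \<Omega>"
  shows "(\<lambda>_. 1) \<in> W_space s \<Omega>" "W_seminorm s \<Omega> (\<lambda>_. 1) = 0"
    "L1_norm \<Omega> (\<lambda>_. 1) = ennreal (measure lborel \<Omega>)"
proof -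
  have B: "\<Omega> \<in> sets borel" using assms by simp
  have fin: "emeasure lborel \<Omega> < \<infinity>" using assms(2) by (rule emeasure_bounded_finite)
  show W: "W_seminorm s \<Omega> (\<lambda>_. 1) = 0" by (simp add: W_seminorm_def)
  have "L1_norm \<Omega> (\<lambda>_. 1) = (\<integral>\<^sup>+x. indicator \<Omega> x * 1 \<partial>lborel)"
    unfolding L1_norm_def by (intro nn_integral_lebesgue_on_cong_AE B) simp
  also have "\<dots> = emeasure lborel \<Omega>" using B by simp
  finally have N: "L1_norm \<Omega> (\<lambda>_. 1) = emeasure lborel \<Omega>" .
  then show "L1_norm \<Omega> (\<lambda>_. 1) = ennreal (measure lborel \<Omega>)"
    using fin by (simp add: emeasure_eq_ennreal_measure)
  have "integrable (lebesgue_on \<Omega>) (\<lambda>_. 1 :: real)"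
    using N fin by (intro integrableI_bounded) (auto simp: L1_norm_def)
  then show "(\<lambda>_. 1) \<in> W_space s \<Omega>" by (simp add: W_space_def W)
qed

text \<open>With \<sigma> = 1 - s the requirement e^\<sigma> \<ge> 1/2 reads \<sigma> |ln e| \<le>
  ln 2; capping \<sigma> at 1/2 keeps s \<ge> 1/2.\<close>

lemma powr_half_bound:
  fixes e :: real
  assumes "0 < e" "e < 1"
  obtains s :: real where "1/2 \<le> s" "s < 1" "1/2 \<le> e powr (1 - s)"
proof
  define \<sigma> where "\<sigma> = min (1/2) (ln 2 / (- ln e))"
  have l: "0 < - ln e" using ln_less_zero[OF assms] by linarith
  have "0 < ln 2 / (- ln e)" using l by (intro divide_pos_pos) auto
  then have "0 < \<sigma>" unfolding \<sigma>_def by (intro min_less_iff_conj[THEN iffD2]) auto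
  moreover have "\<sigma> \<le> 1/2" unfolding \<sigma>_def by (rule min.cobounded1)
  ultimately show "1/2 \<le> 1 - \<sigma>" "1 - \<sigma> < 1" by linarith+
  have "\<sigma> * (- ln e) \<le> (ln 2 / (- ln e)) * (- ln e)"
    using l by (intro mult_right_mono) (auto simp: \<sigma>_def)
  then have "\<sigma> * (- ln e) \<le> ln 2" using l by simp
  then have "exp (- ln 2) \<le> exp (\<sigma> * ln e)" by simp
  then show "1/2 \<le> e powr (1 - (1 - \<sigma>))" using assms by (simp add: powr_def exp_minus)
qed

text \<open>For u = 1 the seminorm vanishes and the right-hand side is at most a fixed multiple of
  the volume of \<Omega>. For every n some s makes each of the terms j < n at least c T / 4, with c
  and T independent of n, so the left-hand sides are unbounded.\<close>

lemma hardy_series_unbounded: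
  fixes \<Omega> :: "(real^'n) set"
  assumes Om: "bounded_Lipschitz_domain \<Omega>" and R: "0 < R" and \<alpha>: "1 \<le> \<alpha>"
  shows "\<not> (\<exists>C'::real. \<forall>s::real. 1/2 \<le> s \<and> s < 1 \<longrightarrow> (\<forall>u\<in>W_space s \<Omega>.
    hardy_series \<alpha> R s \<Omega> u \<le> ennreal C' * (ennreal (1 - s) * W_seminorm s \<Omega> u + L1_norm \<Omega> u)))"
proof
  assume "\<exists>C'::real. \<forall>s::real. 1/2 \<le> s \<and> s < 1 \<longrightarrow> (\<forall>u\<in>W_space s \<Omega>.
    hardy_series \<alpha> R s \<Omega> u \<le> ennreal C' * (ennreal (1 - s) * W_seminorm s \<Omega> u + L1_norm \<Omega> u))"
  then obtain C' where C': "\<And>s u. 1/2 \<le> s \<Longrightarrow> s < 1 \<Longrightarrow> u \<in> W_space s \<Omega> \<Longrightarrow>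
    hardy_series \<alpha> R s \<Omega> u \<le> ennreal C' * (ennreal (1 - s) * W_seminorm s \<Omega> u + L1_norm \<Omega> u)"
    by blast
  note Om' = bounded_Lipschitz_domainD[OF Om]
  have Om_sets: "\<Omega> \<in> sets borel" using Om'(2) by simp
  obtain p where p: "p \<in> frontier \<Omega>" using Om' by blast
  have R2: "0 < R / 2" using R by simp
  obtain Z \<eta> \<nu> K a \<rho> where chart: "boundary_chart \<Omega> Z (bdist \<Omega>) \<eta> \<nu> K a" and a_le: "a \<le> R / 2"
    and Z': "p \<in> Z" "open Z" "continuous_on UNIV \<eta>" "\<eta> p = 0"
    by (rule boundary_chart_exists[OF Om p R2]) (rule that)
  interpret boundary_chart \<Omega> Z "bdist \<Omega>" \<eta> \<nu> K a by (rule chart)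
  obtain c where c: "0 < c" "ennreal c \<le> emeasure lborel {x\<in>Z. 0 \<le> \<eta> x \<and> \<eta> x < 1}"
    using chart_volume_pos[OF Z'(2,3,1,4)] by blast
  \<comment> \<open>The upper end a / 2 of the height interval, rescaled by K R. At T every iterated
    logarithm is at least T.\<close>
  define T where "T = a / 2 / (K * R)"
  have KR: "0 < K * R" "R \<le> K * R" using K R mult_right_mono[of 1 K R] by auto
  have "a / 2 < K * R" using a(1) KR a_le by linarith
  then have T: "0 < T" "T < 1" unfolding T_def using a KR(1) by (auto simp only: pos_divide_less_eq intro!: divide_pos_pos)
  \<comment> \<open>A negative \<open>C'\<close> acts as 0 under \<open>ennreal\<close>, hence the
    maximum.\<close>
  define B where "B = max 0 C' * measure lborel \<Omega>"
  have bound: "real n * (c * T / 4) \<le> B" for n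
  proof -
    obtain t where t: "0 < t" "t < 1" "log_L (Suc n) t \<le> T / 2"
      using log_L_small[of "T / 2" "Suc n"] T by auto
    \<comment> \<open>Makes e / (K R) \<le> t and e < a / 2. It is fixed before s, which is then
      taken so near 1 that e^(1-s) \<ge> 1/2.\<close>
    define e where "e = min (t * (K * R)) (a / 4)"
    have e: "0 < e" "e < a / 2" "e < 1" using t KR a by (auto simp: e_def)
    have et: "0 < e / (K * R)" "e / (K * R) \<le> t" "e / (K * R) < 1"
    proof -
      show "0 < e / (K * R)" using e KR by simp
      show "e / (K * R) \<le> t" using KR by (simp add: e_def pos_divide_le_eq)
      then show "e / (K * R) < 1" using t by linarith
    qed
    obtain s where s: "1/2 \<le> s" "s < 1" "1/2 \<le> e powr (1 - s)"
      using powr_half_bound[OF e(1,3)] by blast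
    have term_ge: "ennreal (c * T / 4) \<le> ennreal (\<alpha> ^ (j + 2)) * hardy_integral R (j + 2) s \<Omega> (\<lambda>_. 1)"
      if j: "j < n" for j
    proof -
      \<comment> \<open>The term of index j has level j + 2 \<le> n + 1, which is why t was chosen
        for level \<open>Suc n\<close>: the value at the lower end is at most T / 2, the value at T
        at least T.\<close>
      let ?D = "log_L (Suc (Suc j)) T - log_L (Suc (Suc j)) (e / (K * R))"
      have "T \<le> log_L (Suc (Suc j)) T"
        using log_L_incseq[OF T, of 0 "Suc (Suc j)"] by simp
      moreover have "log_L (Suc (Suc j)) (e / (K * R)) \<le> log_L (Suc n) (e / (K * R))"
        using j et by (intro log_L_incseq) auto
      moreover have "log_L (Suc n) (e / (K * R)) \<le> log_L (Suc n) t"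
        using et t by (intro log_L_mono) auto
      ultimately have "T / 2 \<le> ?D" using t by linarith
      then have "1/2 * (T / 2) \<le> e powr (1 - s) * ?D"
        using s T by (intro mult_mono) auto
      then have "c * (1/2 * (T / 2)) \<le> c * (e powr (1 - s) * ?D)"
        using c by (intro mult_left_mono) auto
      then have "ennreal (c * T / 4) \<le> ennreal (c * (e powr (1 - s) * ?D))"
        by (intro ennreal_leI) simp
      also have "\<dots> \<le> (\<integral>\<^sup>+x. indicator \<Omega> x *
          ennreal (1 / bdist \<Omega> x powr s * log_weight (Suc (Suc j)) (bdist \<Omega> x / R)) \<partial>lborel)"
        unfolding T_def using s a_le e(1,2) c by (intro chart_weight_integral_ge) auto
      also have "\<dots> = hardy_integral R (j + 2) s \<Omega> (\<lambda>_. 1)"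
        unfolding hardy_integral_def using Om_sets
        by (intro nn_integral_lebesgue_on_cong_AE[symmetric]) auto
      also have "\<dots> \<le> ennreal (\<alpha> ^ (j + 2)) * hardy_integral R (j + 2) s \<Omega> (\<lambda>_. 1)"
      proof -
        have "ennreal 1 \<le> ennreal (\<alpha> ^ (j + 2))" using \<alpha> by (intro ennreal_leI one_le_power)
        from mult_right_mono[OF this] show ?thesis by simp
      qed
      finally show ?thesis .
    qed
    have "ennreal (real n * (c * T / 4)) = ennreal (real n) * ennreal (c * T / 4)"
      using c T by (intro ennreal_mult) auto
    also have "\<dots> = (\<Sum>j<n. ennreal (c * T / 4))"
      by (simp only: sum_constant card_lessThan ennreal_of_nat_eq_real_of_nat)
    also have "\<dots> \<le> (\<Sum>j<n. ennreal (\<alpha> ^ (j + 2)) * hardy_integral R (j + 2) s \<Omega> (\<lambda>_. 1))"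
      by (intro sum_mono term_ge) auto
    also have "\<dots> \<le> hardy_series \<alpha> R s \<Omega> (\<lambda>_. 1)"
      unfolding hardy_series_def by (intro sum_le_suminf summableI) auto
    also have "\<dots> \<le> ennreal C' * (ennreal (1 - s) * W_seminorm s \<Omega> (\<lambda>_. 1) + L1_norm \<Omega> (\<lambda>_. 1))"
      using const_in_W_space[OF Om'(2,3)] s by (intro C') auto
    also have "\<dots> = ennreal C' * ennreal (measure lborel \<Omega>)"
      using const_in_W_space[OF Om'(2,3)] by simp
    also have "\<dots> \<le> ennreal (max 0 C') * ennreal (measure lborel \<Omega>)"
      by (intro mult_right_mono ennreal_leI) auto
    also have "\<dots> = ennreal B" unfolding B_def by (rule ennreal_mult[symmetric]) auto
    finally show ?thesis by (simp add: B_def ennreal_le_iff)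
  qed
  have "0 < c * T / 4" using c T by simp
  then obtain n where "B < real n * (c * T / 4)" using reals_Archimedean3 by blast
  then show False using bound[of n] by linarith
qed

section \<open>Summation for small \<alpha> and the three statements\<close>

lemma hardy_series_le:
  assumes \<alpha>: "0 < \<alpha>" "\<alpha> < 1" and le: "\<And>m. 2 \<le> m \<Longrightarrow> hardy_integral R m s \<Omega> u \<le> X"
  shows "hardy_series \<alpha> R s \<Omega> u \<le> ennreal (\<alpha>\<^sup>2 / (1 - \<alpha>)) * X"
proof -
  have "hardy_series \<alpha> R s \<Omega> u \<le> (\<Sum>j. ennreal (\<alpha> ^ (j + 2)) * X)"
    unfolding hardy_series_def by (intro suminf_le mult_left_mono le summableI) auto
  also have "\<dots> = (\<Sum>j. ennreal (\<alpha> ^ (j + 2))) * X" by simp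
  also have "(\<Sum>j. ennreal (\<alpha> ^ (j + 2))) = ennreal (\<alpha>\<^sup>2 / (1 - \<alpha>))"
  proof -
    have "(\<lambda>j. \<alpha>\<^sup>2 * \<alpha> ^ j) sums (\<alpha>\<^sup>2 * (1 / (1 - \<alpha>)))"
      using \<alpha> by (intro sums_mult geometric_sums) auto
    then have "(\<lambda>j. \<alpha> ^ (j + 2)) sums (\<alpha>\<^sup>2 / (1 - \<alpha>))" by (simp add: power2_eq_square mult_ac)
    then show ?thesis using \<alpha> by (intro suminf_ennreal_eq) auto
  qed
  finally show ?thesis .
qed

theorem theorem2:
  fixes \<Omega> :: "(real^'n) set"
  assumes "bounded_Lipschitz_domain \<Omega>"
  shows
    "(\<exists>C::real. C > 0 \<and>
        (\<forall>R>0. (\<forall>x\<in>\<Omega>. bdist \<Omega> x < R) \<longrightarrow>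
          (\<forall>m::nat. m \<ge> 2 \<longrightarrow> (\<forall>s::real. 1/2 \<le> s \<and> s < 1 \<longrightarrow> (\<forall>u\<in>W_space s \<Omega>.
             hardy_integral R m s \<Omega> u
               \<le> ennreal (C * 2 ^ m * (1 - s)) * W_seminorm s \<Omega> u
                 + ennreal (C * 2 ^ m) * L1_norm \<Omega> u)))))
     \<and>
     (\<exists>C::real. C > 0 \<and>
        (\<forall>R>0. (\<forall>x\<in>\<Omega>. bdist \<Omega> x < R) \<longrightarrow>
          (\<forall>\<alpha>::real. 0 < \<alpha> \<and> \<alpha> < 1/2 \<longrightarrow> (\<forall>s::real. 1/2 \<le> s \<and> s < 1 \<longrightarrow> (\<forall>u\<in>W_space s \<Omega>.
             hardy_series \<alpha> R s \<Omega> u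
               \<le> ennreal (C * (4 * \<alpha>\<^sup>2 / (1 - 2 * \<alpha>)))
                 * (ennreal (1 - s) * W_seminorm s \<Omega> u + L1_norm \<Omega> u))))))
     \<and>
     (\<forall>R>0. (\<forall>x\<in>\<Omega>. bdist \<Omega> x < R) \<longrightarrow>
        (\<forall>\<alpha>::real. \<alpha> \<ge> 1 \<longrightarrow>
          \<not> (\<exists>C'::real. \<forall>s::real. 1/2 \<le> s \<and> s < 1 \<longrightarrow> (\<forall>u\<in>W_space s \<Omega>.
             hardy_series \<alpha> R s \<Omega> u
               \<le> ennreal C' * (ennreal (1 - s) * W_seminorm s \<Omega> u + L1_norm \<Omega> u)))))"
proof -
  obtain C where C: "0 < C" and le: "\<And>R m s u. 0 < R \<Longrightarrow> \<forall>x\<in>\<Omega>. bdist \<Omega> x < R \<Longrightarrow> 1 \<le> m \<Longrightarrow> 0 \<le> s \<Longrightarrow>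
      s < 1 \<Longrightarrow> u \<in> W_space s \<Omega> \<Longrightarrow>
      hardy_integral R m s \<Omega> u \<le> ennreal C * (ennreal (1 - s) * W_seminorm s \<Omega> u + L1_norm \<Omega> u)"
    using hardy_uniform[OF assms] by blast
  have 1: "hardy_integral R m s \<Omega> u
      \<le> ennreal (C * 2 ^ m * (1 - s)) * W_seminorm s \<Omega> u + ennreal (C * 2 ^ m) * L1_norm \<Omega> u"
    if H: "0 < R" "\<forall>x\<in>\<Omega>. bdist \<Omega> x < R" "2 \<le> m" "1/2 \<le> s" "s < 1" "u \<in> W_space s \<Omega>" for R m s u
  proof -
    have "C * 1 \<le> C * 2 ^ m" using C by (intro mult_left_mono) auto
    then have C2: "ennreal C \<le> ennreal (C * 2 ^ m)" by (intro ennreal_leI) simp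
    have "hardy_integral R m s \<Omega> u \<le> ennreal C * (ennreal (1 - s) * W_seminorm s \<Omega> u + L1_norm \<Omega> u)"
      using H by (intro le) auto
    also have "\<dots> \<le> ennreal (C * 2 ^ m) * (ennreal (1 - s) * W_seminorm s \<Omega> u + L1_norm \<Omega> u)"
      by (intro mult_right_mono C2) simp
    also have "\<dots> = ennreal (C * 2 ^ m * (1 - s)) * W_seminorm s \<Omega> u + ennreal (C * 2 ^ m) * L1_norm \<Omega> u"
      using C H(5) by (subst (2) ennreal_mult) (auto simp: distrib_left mult.assoc)
    finally show ?thesis .
  qed
  have 2: "hardy_series \<alpha> R s \<Omega> u \<le> ennreal (C * (4 * \<alpha>\<^sup>2 / (1 - 2 * \<alpha>)))
      * (ennreal (1 - s) * W_seminorm s \<Omega> u + L1_norm \<Omega> u)"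
    if H: "0 < R" "\<forall>x\<in>\<Omega>. bdist \<Omega> x < R" "0 < \<alpha>" "\<alpha> < 1/2" "1/2 \<le> s" "s < 1" "u \<in> W_space s \<Omega>" for R \<alpha> s u
  proof -
    let ?X = "ennreal (1 - s) * W_seminorm s \<Omega> u + L1_norm \<Omega> u"
    have "hardy_series \<alpha> R s \<Omega> u \<le> ennreal (\<alpha>\<^sup>2 / (1 - \<alpha>)) * (ennreal C * ?X)"
      using H by (intro hardy_series_le le) auto
    also have "\<dots> = ennreal (C * (\<alpha>\<^sup>2 / (1 - \<alpha>))) * ?X"
      using C H by (subst ennreal_mult) (auto simp: mult_ac)
    \<comment> \<open>Compares \<alpha>^2 \<le> 4 \<alpha>^2 and 1 - 2 \<alpha> \<le> 1 - \<alpha>,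
      where \<alpha> < 1/2 keeps the smaller denominator positive.\<close>
    also have "\<dots> \<le> ennreal (C * (4 * \<alpha>\<^sup>2 / (1 - 2 * \<alpha>))) * ?X"
      using C H by (intro mult_right_mono ennreal_leI mult_left_mono frac_le) auto
    finally show ?thesis .
  qed
  show ?thesis
    using C 1 2 hardy_series_unbounded[OF assms] by (intro conjI exI[of _ C]) blast+
qed

end
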